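(* Let $\eta$, $\Omega$ (bounded Lipschitz domain), $\rho\in C^{1,\alpha}(\Omega)$ with $\alpha\in(0,1]$, the averaging operator $\mathcal M_\varepsilon$, $\eta_\varepsilon^{x}$, the repeated convolution $\psi_{k,\varepsilon}$ and $R_k$ be as in the context, and write $\varepsilon_k=\varepsilon\sqrt k$. There exist constants $c,C>0$ such that the following holds. Let $k\ge1$, $R\ge R_k$, and let $x_0\in\Omega$ with $B(x_0,R)\subset\Omega$. If $[\nabla\rho]_\alpha k\varepsilon^{1+\alpha}\le c$ and $\varepsilon\le c$, then for all $x\in\Omega$ $$\mathcal M^k_\varepsilon\eta^{x_0}_\varepsilon(x)=(1+E_1)\,\psi_{k+1,\varepsilon}(x-x_0)+E_2$$ for some real numbers $E_1,E_2$ (depending on $x$) with $$|E_1|\le C[\nabla\rho]_\alpha k\varepsilon^{1+\alpha},\qquad|E_2|\le C\varepsilon^2\exp\left(-\frac{R^2}{4d\varepsilon_k^2}\right).$$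
   Context: Kernel: $\eta:[0,\infty)\to[0,\infty)$ is continuous at $0$ with $\eta(0)>0$, non-increasing, $\operatorname{supp}\eta\subset[0,1]$, $\int_{B(0,1)}\eta(|z|)\,dz=1$; $\eta_\varepsilon(t)=\varepsilon^{-d}\eta(t/\varepsilon)$; $\eta^x_\varepsilon(y)=\eta_\varepsilon(|x-y|)$. $\Omega\subset\mathbb R^d$ is a bounded domain (open, connected) with Lipschitz boundary; $\rho\in C^{1,\alpha}(\Omega)$ is a probability density with $0<\rho_{\min}\le\rho\le\rho_{\max}<\infty$, and $[\nabla\rho]_\alpha=\sup_{x\ne y}|\nabla\rho(x)-\nabla\rho(y)|/|x-y|^\alpha$. Standing assumption: $0<\varepsilon\le\frac12$ and $\varepsilon_k=\varepsilon\sqrt k\le1$. Averaging: $\hat\rho_\varepsilon(x)=\int_\Omega\eta_\varepsilon(|x-y|)\rho(y)\,dy$, $\mathcal M_\varepsilon\phi(x)=\int_\Omega\eta_\varepsilon(|x-y|)\hat\rho_\varepsilon(y)^{-1}\rho(y)\phi(y)\,dy$; $\mathcal M_\varepsilon^k$ is the $k$-fold iterate. $\psi_{k,\varepsilon}=\eta_\varepsilon*\cdots*\eta_\varepsilon$ ($k$-fold convolution on $\mathbb R^d$ of $z\mapsto\eta_\varepsilon(|z|)$, with $\psi_{1,\varepsilon}=\eta_\varepsilon$). $R_k=5\varepsilon+\varepsilon_k\sqrt{8d\log(k\varepsilon^{-(d+2)})}$. The constants $c,C$ depend only on $\Omega,d,\rho_{\min},\rho_{\max},\eta$. *)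

theory Defs
  imports "HOL-Analysis.Analysis"
begin

(* Near each boundary point p, after choosing an "upward" unit vector u, the set is the part
   lying above the graph of a Lipschitz function g on the hyperplane orthogonal to u; the
   coordinates of x are (x - (x \<bullet> u) u, x \<bullet> u). *)
definition lipschitz_boundary :: "'a::euclidean_space set \<Rightarrow> bool" where
  "lipschitz_boundary \<Omega> \<longleftrightarrow>
     (\<forall>p\<in>frontier \<Omega>. \<exists>r>0. \<exists>u. norm u = 1 \<and>
        (\<exists>L g. L-lipschitz_on {v. v \<bullet> u = 0} (g :: 'a \<Rightarrow> real) \<and>
           \<Omega> \<inter> ball p r = {x \<in> ball p r. x \<bullet> u > g (x - (x \<bullet> u) *\<^sub>R u)}))"

definition grad :: "('a::euclidean_space \<Rightarrow> real) \<Rightarrow> 'a \<Rightarrow> 'a" where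
  "grad f x = (THE D. GDERIV f x :> D)"

definition grad_quotients :: "real \<Rightarrow> 'a::euclidean_space set \<Rightarrow> ('a \<Rightarrow> real) \<Rightarrow> real set" where
  "grad_quotients \<alpha> \<Omega> f =
     {norm (grad f x - grad f y) / norm (x - y) powr \<alpha> | x y. x \<in> \<Omega> \<and> y \<in> \<Omega> \<and> x \<noteq> y}"

(* The seminorm of the gradient; the supremum is meaningful because C1_holder
   requires it to be finite. *)
definition grad_seminorm :: "real \<Rightarrow> 'a::euclidean_space set \<Rightarrow> ('a \<Rightarrow> real) \<Rightarrow> real" where
  "grad_seminorm \<alpha> \<Omega> f = Sup (grad_quotients \<alpha> \<Omega> f)"

(* Intended for bounded domains with Lipschitz boundary, where finiteness of the seminorm
   implies that f and its gradient are bounded. *)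
definition C1_holder :: "real \<Rightarrow> 'a::euclidean_space set \<Rightarrow> ('a \<Rightarrow> real) \<Rightarrow> bool" where
  "C1_holder \<alpha> \<Omega> f \<longleftrightarrow>
     (\<forall>x\<in>\<Omega>. \<exists>D. GDERIV f x :> D) \<and> continuous_on \<Omega> (grad f) \<and>
     bdd_above (grad_quotients \<alpha> \<Omega> f)"

definition scaled_kernel :: "nat \<Rightarrow> (real \<Rightarrow> real) \<Rightarrow> real \<Rightarrow> real \<Rightarrow> real" where
  "scaled_kernel d \<eta> \<epsilon> t = \<eta> (t / \<epsilon>) / \<epsilon> ^ d"

definition centered_kernel ::
    "(real \<Rightarrow> real) \<Rightarrow> real \<Rightarrow> 'a::euclidean_space \<Rightarrow> 'a \<Rightarrow> real" where
  "centered_kernel \<eta> \<epsilon> x y = scaled_kernel DIM('a) \<eta> \<epsilon> (norm (x - y))"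

definition smoothed_density ::
    "(real \<Rightarrow> real) \<Rightarrow> real \<Rightarrow> 'a::euclidean_space set \<Rightarrow> ('a \<Rightarrow> real) \<Rightarrow> 'a \<Rightarrow> real" where
  "smoothed_density \<eta> \<epsilon> \<Omega> \<rho> x =
     (LINT y:\<Omega>|lborel. scaled_kernel DIM('a) \<eta> \<epsilon> (norm (x - y)) * \<rho> y)"

definition averaging ::
    "(real \<Rightarrow> real) \<Rightarrow> real \<Rightarrow> 'a::euclidean_space set \<Rightarrow> ('a \<Rightarrow> real) \<Rightarrow> ('a \<Rightarrow> real) \<Rightarrow> 'a \<Rightarrow> real" where
  "averaging \<eta> \<epsilon> \<Omega> \<rho> \<phi> x =
     (LINT y:\<Omega>|lborel. scaled_kernel DIM('a) \<eta> \<epsilon> (norm (x - y))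
        * inverse (smoothed_density \<eta> \<epsilon> \<Omega> \<rho> y) * \<rho> y * \<phi> y)"

definition convolve :: "('a::euclidean_space \<Rightarrow> real) \<Rightarrow> ('a \<Rightarrow> real) \<Rightarrow> 'a \<Rightarrow> real" where
  "convolve f g x = (LINT y|lborel. f (x - y) * g y)"

(* k-fold convolution with k factors, for k \<ge> 1 (the value at k = 0 is irrelevant). *)
definition \<psi> :: "(real \<Rightarrow> real) \<Rightarrow> real \<Rightarrow> nat \<Rightarrow> 'a::euclidean_space \<Rightarrow> real" where
  "\<psi> \<eta> \<epsilon> k =
     (convolve (\<lambda>z. scaled_kernel DIM('a) \<eta> \<epsilon> (norm z)) ^^ (k - 1))
       (\<lambda>z. scaled_kernel DIM('a) \<eta> \<epsilon> (norm z))"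

definition eps_k :: "real \<Rightarrow> nat \<Rightarrow> real" where
  "eps_k \<epsilon> k = \<epsilon> * sqrt (real k)"

definition R_k :: "nat \<Rightarrow> real \<Rightarrow> nat \<Rightarrow> real" where
  "R_k d \<epsilon> k = 5 * \<epsilon> + eps_k \<epsilon> k * sqrt (8 * real d * ln (real k / \<epsilon> ^ (d + 2)))"

end

theory Submission
  imports Defs
begin

text \<open>
  Expanded, the iterated average is an integral over paths from \<open>x0\<close> to \<open>x\<close> with steps of length
  at most \<open>\<epsilon>\<close>, each intermediate point \<open>y\<close> carrying the weight \<open>w y = \<rho> y / \<rho>h y\<close>, where \<open>\<rho>h\<close> is the
  smoothed density; the repeated convolution is the same integral with \<open>w = 1\<close>. As long as
  a path stays in the ball of radius \<open>R - \<epsilon>\<close>, the even kernel annihilates the linear Taylor term of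
  \<open>\<rho>\<close>, so \<open>w = 1 + O([\<nabla>\<rho>] \<epsilon> powr (1 + \<alpha>))\<close>; the product of these factors along \<open>k\<close> points is \<open>1 + E1\<close>.
  The paths that leave the ball form \<open>E2\<close>. The weight is comparable to \<open>1\<close> up to the first exit, and
  afterwards the averaging operator conserves the mass with respect to \<open>\<rho>\<close>, so the escaped mass is
  bounded by the Gaussian tail of the free walk. In passing from mass to pointwise values a lower
  bound for \<open>\<rho>h\<close> is needed, which is where the Lipschitz boundary enters.
\<close>

section \<open>Paths staying in a set and paths leaving it\<close>

text \<open>Extended nonnegative values make Tonelli and monotonicity available without
  integrability conditions. The weight is attached to the integration variable, so \<open>n\<close>
  applications put exactly one weight on each of the \<open>n\<close> intermediate points and none
  on the endpoint \<open>x\<close>.\<close>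

definition kernel_op ::
    "('a::euclidean_space \<Rightarrow> ennreal) \<Rightarrow> ('a \<Rightarrow> ennreal) \<Rightarrow> ('a \<Rightarrow> ennreal) \<Rightarrow> 'a \<Rightarrow> ennreal" where
  "kernel_op h w f x = (\<integral>\<^sup>+y. h (x - y) * (w y * f y) \<partial>lborel)"

text \<open>
  \<open>stay\<close> and \<open>leak\<close> split the iterated kernel according to whether all intermediate points lie in
  \<open>A\<close>; endpoints are unrestricted. Keeping \<open>leak\<close> as a separate recursion avoids subtraction
  in \<^typ>\<open>ennreal\<close>.
\<close>

primrec stay ::
    "('a::euclidean_space \<Rightarrow> ennreal) \<Rightarrow> ('a \<Rightarrow> ennreal) \<Rightarrow> 'a set \<Rightarrow> ('a \<Rightarrow> ennreal) \<Rightarrow> nat \<Rightarrow> 'a \<Rightarrow> ennreal" where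
  "stay h w A g 0 = g"
| "stay h w A g (Suc n) = kernel_op h w (\<lambda>y. indicator A y * stay h w A g n y)"

primrec leak ::
    "('a::euclidean_space \<Rightarrow> ennreal) \<Rightarrow> ('a \<Rightarrow> ennreal) \<Rightarrow> 'a set \<Rightarrow> ('a \<Rightarrow> ennreal) \<Rightarrow> nat \<Rightarrow> 'a \<Rightarrow> ennreal" where
  "leak h w A g 0 = (\<lambda>_. 0)"
| "leak h w A g (Suc n) =
     kernel_op h w (\<lambda>y. leak h w A g n y + indicator (- A) y * stay h w A g n y)"

lemma kernel_op_measurable [measurable (raw)]:
  assumes [measurable]: "h \<in> borel_measurable borel" "w \<in> borel_measurable borel" "f \<in> borel_measurable borel"
  shows "kernel_op h w f \<in> borel_measurable borel"
  unfolding kernel_op_def by measurable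

lemma stay_measurable [measurable]:
  assumes [measurable]: "h \<in> borel_measurable borel" "w \<in> borel_measurable borel" "g \<in> borel_measurable borel"
    "A \<in> sets borel"
  shows "stay h w A g n \<in> borel_measurable borel"
  by (induction n) simp_all

lemma leak_measurable [measurable]:
  assumes [measurable]: "h \<in> borel_measurable borel" "w \<in> borel_measurable borel" "g \<in> borel_measurable borel"
    "A \<in> sets borel"
  shows "leak h w A g n \<in> borel_measurable borel"
  by (induction n) simp_all

lemma kernel_op_iterate_measurable [measurable]:
  assumes [measurable]: "h \<in> borel_measurable borel" "w \<in> borel_measurable borel" "g \<in> borel_measurable borel"
  shows "(kernel_op h w ^^ n) g \<in> borel_measurable borel"
  by (induction n) simp_all

lemma kernel_op_add:
  assumes [measurable]: "h \<in> borel_measurable borel" "w \<in> borel_measurable borel"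
    "f \<in> borel_measurable borel" "g \<in> borel_measurable borel"
  shows "kernel_op h w (\<lambda>y. f y + g y) x = kernel_op h w f x + kernel_op h w g x"
  unfolding kernel_op_def by (subst nn_integral_add[symmetric]) (auto simp: distrib_left)

text \<open>Every path either has all its intermediate points in \<open>A\<close> or has some such
  point outside. At each step the new intermediate point decides whether a path counted by
  \<open>stay\<close> remains there or moves to \<open>leak\<close>.\<close>

lemma iterate_eq_stay_plus_leak:
  assumes [measurable]: "h \<in> borel_measurable borel" "w \<in> borel_measurable borel" "g \<in> borel_measurable borel"
    "A \<in> sets borel"
  shows "(kernel_op h w ^^ n) g = (\<lambda>x. stay h w A g n x + leak h w A g n x)"
proof (induction n)
  case (Suc n)
  have "(\<lambda>y. stay h w A g n y + leak h w A g n y)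
      = (\<lambda>y. indicator A y * stay h w A g n y + (leak h w A g n y + indicator (- A) y * stay h w A g n y))"
    by (auto simp: indicator_def add_ac)
  then show ?case
    by (simp add: Suc kernel_op_add)
qed simp

lemma stay_le_iterate:
  assumes "h \<in> borel_measurable borel" "w \<in> borel_measurable borel" "g \<in> borel_measurable borel"
    "A \<in> sets borel"
  shows "stay h w A g n x \<le> (kernel_op h w ^^ n) g x"
  by (simp add: iterate_eq_stay_plus_leak[OF assms])

text \<open>A path counted by \<open>stay\<close> carries \<open>n\<close> weights, all evaluated in
  \<open>A\<close>, hence each is at most \<open>b\<close>; the induction peels them off one by
  one.\<close>

lemma stay_le_power:
  assumes [measurable]: "h \<in> borel_measurable borel" "w \<in> borel_measurable borel" "g \<in> borel_measurable borel"
    "A \<in> sets borel"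
    and w: "\<And>y. y \<in> A \<Longrightarrow> w y \<le> b"
  shows "stay h w A g n x \<le> b ^ n * stay h (\<lambda>_. 1) A g n x"
proof (induction n arbitrary: x)
  case (Suc n)
  have "h (x - y) * (w y * (indicator A y * stay h w A g n y))
      \<le> (b * b ^ n) * (h (x - y) * (1 * (indicator A y * stay h (\<lambda>_. 1) A g n y)))" for y
  proof (cases "y \<in> A")
    case True
    have "h (x - y) * (w y * stay h w A g n y) \<le> h (x - y) * (b * (b ^ n * stay h (\<lambda>_. 1) A g n y))"
      by (intro mult_left_mono mult_mono w Suc True) auto
    with True show ?thesis by (simp add: ac_simps)
  qed simp
  then have "kernel_op h w (\<lambda>y. indicator A y * stay h w A g n y) x
      \<le> (\<integral>\<^sup>+y. (b * b ^ n) * (h (x - y) * (1 * (indicator A y * stay h (\<lambda>_. 1) A g n y))) \<partial>lborel)"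
    unfolding kernel_op_def by (rule nn_integral_mono)
  also have "\<dots> = b ^ Suc n * stay h (\<lambda>_. 1) A g (Suc n) x"
    unfolding stay.simps kernel_op_def power_Suc by (rule nn_integral_cmult) measurable
  finally show ?case by simp
qed simp

lemma power_le_stay:
  assumes [measurable]: "h \<in> borel_measurable borel" "w \<in> borel_measurable borel" "g \<in> borel_measurable borel"
    "A \<in> sets borel"
    and w: "\<And>y. y \<in> A \<Longrightarrow> a \<le> w y"
  shows "a ^ n * stay h (\<lambda>_. 1) A g n x \<le> stay h w A g n x"
proof (induction n arbitrary: x)
  case (Suc n)
  have "(a * a ^ n) * (h (x - y) * (1 * (indicator A y * stay h (\<lambda>_. 1) A g n y)))
      \<le> h (x - y) * (w y * (indicator A y * stay h w A g n y))" for y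
  proof (cases "y \<in> A")
    case True
    have "h (x - y) * (a * (a ^ n * stay h (\<lambda>_. 1) A g n y)) \<le> h (x - y) * (w y * stay h w A g n y)"
      by (intro mult_left_mono mult_mono w Suc True) auto
    with True show ?thesis by (simp add: ac_simps)
  qed simp
  then have "(\<integral>\<^sup>+y. (a * a ^ n) * (h (x - y) * (1 * (indicator A y * stay h (\<lambda>_. 1) A g n y))) \<partial>lborel)
      \<le> kernel_op h w (\<lambda>y. indicator A y * stay h w A g n y) x"
    unfolding kernel_op_def by (rule nn_integral_mono)
  moreover have "(\<integral>\<^sup>+y. (a * a ^ n) * (h (x - y) * (1 * (indicator A y * stay h (\<lambda>_. 1) A g n y))) \<partial>lborel)
      = a ^ Suc n * stay h (\<lambda>_. 1) A g (Suc n) x"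
    unfolding stay.simps kernel_op_def power_Suc by (rule nn_integral_cmult) measurable
  ultimately show ?case by simp
qed simp

text \<open>
  Used with \<open>m = \<rho>\<close> and \<open>q = 1\<close> (conservation of mass) and with \<open>m\<close> an exponential and \<open>q\<close> its
  moment under the kernel.
\<close>

lemma nn_integral_kernel_op_le:
  assumes [measurable]: "h \<in> borel_measurable borel" "w \<in> borel_measurable borel" "f \<in> borel_measurable borel"
    "m \<in> borel_measurable borel"
    and m: "\<And>y. (\<integral>\<^sup>+x. m x * h (x - y) \<partial>lborel) * w y \<le> q * m y"
  shows "(\<integral>\<^sup>+x. m x * kernel_op h w f x \<partial>lborel) \<le> q * (\<integral>\<^sup>+y. m y * f y \<partial>lborel)"
proof -
  have "(\<integral>\<^sup>+x. m x * kernel_op h w f x \<partial>lborel)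
      = (\<integral>\<^sup>+x. \<integral>\<^sup>+y. m x * (h (x - y) * (w y * f y)) \<partial>lborel \<partial>lborel)"
    unfolding kernel_op_def by (simp add: nn_integral_cmult)
  also have "\<dots> = (\<integral>\<^sup>+y. \<integral>\<^sup>+x. m x * (h (x - y) * (w y * f y)) \<partial>lborel \<partial>lborel)"
    by (rule lborel_pair.Fubini') simp
  also have "\<dots> = (\<integral>\<^sup>+y. ((\<integral>\<^sup>+x. m x * h (x - y) \<partial>lborel) * w y) * f y \<partial>lborel)"
    by (intro nn_integral_cong, subst nn_integral_multc[symmetric], measurable,
        subst nn_integral_multc[symmetric], measurable) (simp add: mult.assoc)
  also have "\<dots> \<le> (\<integral>\<^sup>+y. q * (m y * f y) \<partial>lborel)"
    using m by (intro nn_integral_mono) (simp add: mult.assoc[symmetric] mult_right_mono)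
  also have "\<dots> = q * (\<integral>\<^sup>+y. m y * f y \<partial>lborel)"
    by (simp add: nn_integral_cmult)
  finally show ?thesis .
qed

text \<open>Hypothesis \<open>m\<close> says that one step does not increase the mass with respect
  to \<open>m\<close>. So the leaked mass grows at step \<open>j\<close> by at most what lies
  outside \<open>A\<close> for the first time, which gives a sum over the exit times.\<close>

lemma leak_mass_le:
  assumes [measurable]: "h \<in> borel_measurable borel" "w \<in> borel_measurable borel" "g \<in> borel_measurable borel"
    "m \<in> borel_measurable borel" "A \<in> sets borel"
    and m: "\<And>y. (\<integral>\<^sup>+x. m x * h (x - y) \<partial>lborel) * w y \<le> m y"
  shows "(\<integral>\<^sup>+x. m x * leak h w A g n x \<partial>lborel)
    \<le> (\<Sum>j<n. \<integral>\<^sup>+x. m x * (indicator (- A) x * stay h w A g j x) \<partial>lborel)"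
proof (induction n)
  case (Suc n)
  have "(\<integral>\<^sup>+x. m x * leak h w A g (Suc n) x \<partial>lborel)
     \<le> 1 * (\<integral>\<^sup>+x. m x * (leak h w A g n x + indicator (- A) x * stay h w A g n x) \<partial>lborel)"
    unfolding leak.simps by (rule nn_integral_kernel_op_le) (use m in auto)
  also have "\<dots> = (\<integral>\<^sup>+x. m x * leak h w A g n x \<partial>lborel)
      + (\<integral>\<^sup>+x. m x * (indicator (- A) x * stay h w A g n x) \<partial>lborel)"
    by (simp add: distrib_left nn_integral_add)
  also have "\<dots> \<le> (\<Sum>j<Suc n. \<integral>\<^sup>+x. m x * (indicator (- A) x * stay h w A g j x) \<partial>lborel)"
    using Suc by (simp add: add_mono)
  finally show ?case .
qed simp

text \<open>Turns mass into a pointwise bound: in the last step the kernel is replaced by its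
  supremum \<open>H\<close> and the weight by \<open>B * m\<close>, and what remains is the leaked
  mass one step earlier.\<close>

lemma leak_le:
  assumes [measurable]: "h \<in> borel_measurable borel" "w \<in> borel_measurable borel" "g \<in> borel_measurable borel"
    "m \<in> borel_measurable borel" "A \<in> sets borel"
    and m: "\<And>y. (\<integral>\<^sup>+x. m x * h (x - y) \<partial>lborel) * w y \<le> m y"
    and h: "\<And>z. h z \<le> H" and w: "\<And>y. w y \<le> B * m y"
  shows "leak h w A g n x
    \<le> H * B * (\<Sum>j<n. \<integral>\<^sup>+x. m x * (indicator (- A) x * stay h w A g j x) \<partial>lborel)"
proof (cases n)
  case (Suc k)
  define f where "f y = leak h w A g k y + indicator (- A) y * stay h w A g k y" for y
  have [measurable]: "f \<in> borel_measurable borel"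
    unfolding f_def by measurable
  have "h (x - y) * (w y * f y) \<le> H * B * (m y * f y)" for y
  proof -
    have "h (x - y) * (w y * f y) \<le> H * ((B * m y) * f y)"
      by (intro mult_mono h w) auto
    then show ?thesis by (simp add: mult.assoc)
  qed
  then have "kernel_op h w f x \<le> (\<integral>\<^sup>+y. H * B * (m y * f y) \<partial>lborel)"
    unfolding kernel_op_def by (intro nn_integral_mono) auto
  also have "\<dots> = H * B * (\<integral>\<^sup>+y. m y * f y \<partial>lborel)"
    by (simp add: nn_integral_cmult)
  also have "(\<integral>\<^sup>+y. m y * f y \<partial>lborel) = (\<integral>\<^sup>+y. m y * leak h w A g k y \<partial>lborel)
      + (\<integral>\<^sup>+y. m y * (indicator (- A) y * stay h w A g k y) \<partial>lborel)"
    unfolding f_def by (simp add: distrib_left nn_integral_add)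
  also have "H * B * \<dots> \<le> H * B * (\<Sum>j<n. \<integral>\<^sup>+x. m x * (indicator (- A) x * stay h w A g j x) \<partial>lborel)"
    using leak_mass_le[OF assms(1-6), of k] by (intro mult_left_mono) (auto simp: Suc add_mono)
  finally show ?thesis
    by (simp add: Suc f_def[abs_def])
qed simp

section \<open>Gaussian tails of convolution powers\<close>

text \<open>The quotient of the two sides is nonincreasing on the half-line, because its derivative
  has the sign of \<open>sinh t - t * cosh t\<close>; evenness reduces to
  \<open>\<bar>x\<bar>\<close>.\<close>

lemma cosh_le_exp_half_square: "cosh (x::real) \<le> exp (x\<^sup>2 / 2)"
proof -
  have sinh_le: "sinh y \<le> y * cosh y" if "0 \<le> y" for y :: real
  proof -
    have "0 * cosh 0 - sinh 0 \<le> y * cosh y - sinh y"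
    proof (rule DERIV_nonneg_imp_nondecreasing[OF that])
      fix t :: real assume "0 \<le> t" "t \<le> y"
      then show "\<exists>D. ((\<lambda>y. y * cosh y - sinh y) has_real_derivative D) (at t) \<and> 0 \<le> D"
        by (intro exI[of _ "t * sinh t"]) (auto intro!: derivative_eq_intros)
    qed
    then show ?thesis by simp
  qed
  have "cosh \<bar>x\<bar> * exp (- (\<bar>x\<bar>\<^sup>2 / 2)) \<le> cosh 0 * exp (- (0\<^sup>2 / 2))"
  proof (rule DERIV_nonpos_imp_nonincreasing[of 0 "\<bar>x\<bar>" "\<lambda>x. cosh x * exp (- (x\<^sup>2 / 2))"])
    fix t :: real assume "0 \<le> t" "t \<le> \<bar>x\<bar>"
    then show "\<exists>D. ((\<lambda>x. cosh x * exp (- (x\<^sup>2 / 2))) has_real_derivative D) (at t) \<and> D \<le> 0"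
      using sinh_le[of t]
      by (intro exI[of _ "(sinh t - t * cosh t) * exp (- (t\<^sup>2 / 2))"])
         (auto intro!: derivative_eq_intros mult_nonpos_nonneg simp: algebra_simps)
  qed simp
  then show ?thesis
    by (simp add: exp_minus field_simps)
qed

section \<open>Translation and reflection invariance of Lebesgue integrals\<close>

lemma nn_integral_lborel_translate:
  fixes f :: "'a::euclidean_space \<Rightarrow> ennreal"
  assumes [measurable]: "f \<in> borel_measurable borel"
  shows "(\<integral>\<^sup>+x. f (x + c) \<partial>lborel) = (\<integral>\<^sup>+x. f x \<partial>lborel)"
proof -
  have "(\<integral>\<^sup>+x. f x \<partial>lborel) = (\<integral>\<^sup>+x. f x \<partial>distr lborel borel ((+) c))"
    by (simp only: lborel_distr_plus)
  also have "\<dots> = (\<integral>\<^sup>+x. f (c + x) \<partial>lborel)"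
    by (rule nn_integral_distr) auto
  finally show ?thesis by (simp only: add.commute)
qed

lemma lborel_distr_reflect: "distr lborel borel (\<lambda>x. c - x) = (lborel :: 'a::euclidean_space measure)"
  using lborel_affine[of "-1" c] by (simp add: density_1)

lemma nn_integral_lborel_reflect:
  fixes f :: "'a::euclidean_space \<Rightarrow> ennreal"
  assumes [measurable]: "f \<in> borel_measurable borel"
  shows "(\<integral>\<^sup>+x. f (c - x) \<partial>lborel) = (\<integral>\<^sup>+x. f x \<partial>lborel)"
proof -
  have "(\<integral>\<^sup>+x. f x \<partial>lborel) = (\<integral>\<^sup>+x. f x \<partial>distr lborel borel (\<lambda>x. c - x))"
    by (simp only: lborel_distr_reflect)
  also have "\<dots> = (\<integral>\<^sup>+x. f (c - x) \<partial>lborel)"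
    by (rule nn_integral_distr) auto
  finally show ?thesis ..
qed

lemma integral_lborel_reflect:
  fixes f :: "'a::euclidean_space \<Rightarrow> real"
  assumes [measurable]: "f \<in> borel_measurable borel"
  shows "(LINT x|lborel. f (c - x)) = (LINT x|lborel. f x)"
proof -
  have "(LINT x|lborel. f x) = (LINT x|distr lborel borel (\<lambda>x. c - x). f x)"
    by (simp only: lborel_distr_reflect)
  also have "\<dots> = (LINT x|lborel. f (c - x))"
    by (rule integral_distr) auto
  finally show ?thesis ..
qed

text \<open>The density of one step of a random walk: symmetric law, step length at most \<epsilon>.
  Stating the mass as a nonnegative integral yields measure one and integrability at once.\<close>

locale step_kernel =
  fixes h :: "'a::euclidean_space \<Rightarrow> real" and \<epsilon> :: real
  assumes meas [measurable]: "h \<in> borel_measurable borel"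
    and nonneg: "0 \<le> h z"
    and even: "h (- z) = h z"
    and support: "h z \<noteq> 0 \<Longrightarrow> norm z \<le> \<epsilon>"
    and mass: "(\<integral>\<^sup>+z. ennreal (h z) \<partial>lborel) = 1"
begin

lemma eps_nonneg: "0 \<le> \<epsilon>"
proof (rule ccontr)
  assume "\<not> 0 \<le> \<epsilon>"
  then have "h z = 0" for z
    using support[of z] norm_ge_zero[of z] by linarith
  then show False using mass by simp
qed

lemma mass_centered: "(\<integral>\<^sup>+y. ennreal (h (x - y)) \<partial>lborel) = 1"
  using nn_integral_lborel_reflect[of "\<lambda>z. ennreal (h z)" x] mass by simp

lemma mass_centered': "(\<integral>\<^sup>+x. ennreal (h (x - y)) \<partial>lborel) = 1"
  using nn_integral_lborel_translate[of "\<lambda>z. ennreal (h z)" "- y"] mass by simp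

lemma exp_moment_le:
  "(\<integral>\<^sup>+z. ennreal (exp (v \<bullet> z)) * ennreal (h z) \<partial>lborel) \<le> ennreal (exp ((norm v * \<epsilon>)\<^sup>2 / 2))"
    (is "?I \<le> ennreal ?E")
proof -
  have "?I = (\<integral>\<^sup>+z. ennreal (exp (- (v \<bullet> z))) * ennreal (h z) \<partial>lborel)"
    using nn_integral_lborel_reflect[of "\<lambda>z. ennreal (exp (v \<bullet> z)) * ennreal (h z)" 0]
    by (simp add: even)
  then have "2 * ?I = ?I + (\<integral>\<^sup>+z. ennreal (exp (- (v \<bullet> z))) * ennreal (h z) \<partial>lborel)"
    by (simp add: mult_2)
  also have "\<dots> = (\<integral>\<^sup>+z. ennreal (exp (v \<bullet> z)) * ennreal (h z)
        + ennreal (exp (- (v \<bullet> z))) * ennreal (h z) \<partial>lborel)"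
    by (rule nn_integral_add[symmetric]) auto
  also have "\<dots> \<le> (\<integral>\<^sup>+z. ennreal (2 * ?E) * ennreal (h z) \<partial>lborel)"
  proof (rule nn_integral_mono)
    fix z
    have "(exp (v \<bullet> z) + exp (- (v \<bullet> z))) * h z \<le> 2 * ?E * h z"
    proof (cases "h z = 0")
      case False
      have "\<bar>v \<bullet> z\<bar> \<le> norm v * \<epsilon>"
        using Cauchy_Schwarz_ineq2[of v z] mult_left_mono[OF support[OF False] norm_ge_zero[of v]]
        by linarith
      then have "(v \<bullet> z)\<^sup>2 \<le> (norm v * \<epsilon>)\<^sup>2"
        using abs_le_square_iff[of "v \<bullet> z" "norm v * \<epsilon>"] by linarith
      then have "cosh (v \<bullet> z) \<le> ?E"
        using cosh_le_exp_half_square[of "v \<bullet> z"] by (rule_tac order_trans) auto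
      then show ?thesis
        by (intro mult_right_mono nonneg) (simp add: cosh_field_def)
    qed simp
    then show "ennreal (exp (v \<bullet> z)) * ennreal (h z) + ennreal (exp (- (v \<bullet> z))) * ennreal (h z)
        \<le> ennreal (2 * ?E) * ennreal (h z)"
      by (simp add: nonneg ennreal_mult'[symmetric] ennreal_plus[symmetric] algebra_simps
          del: ennreal_plus)
  qed
  also have "\<dots> = 2 * ennreal ?E"
    by (subst nn_integral_cmult) (auto simp: mass ennreal_mult)
  finally show ?thesis
    by (subst (asm) ennreal_mult_le_mult_iff) auto
qed

text \<open>The density of the free walk from \<open>x0\<close> after \<open>n + 1\<close> steps:
  \<open>n\<close> counts applications of the operator, and the initial kernel is already the first
  step.\<close>

abbreviation conv_pow :: "nat \<Rightarrow> 'a \<Rightarrow> 'a \<Rightarrow> ennreal" where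
  "conv_pow n x0 \<equiv> (kernel_op (\<lambda>z. ennreal (h z)) (\<lambda>_. 1) ^^ n) (\<lambda>y. ennreal (h (x0 - y)))"

lemma conv_pow_measurable [measurable]: "conv_pow n x0 \<in> borel_measurable borel"
  by (rule kernel_op_iterate_measurable) auto

text \<open>Exponentials are multiplicative along the steps, so each of the \<open>Suc n\<close>
  independent steps contributes one factor of the single-step moment bound.\<close>

lemma conv_pow_exp_moment:
  "(\<integral>\<^sup>+y. ennreal (exp (v \<bullet> (y - x0))) * conv_pow n x0 y \<partial>lborel)
     \<le> ennreal (exp ((norm v * \<epsilon>)\<^sup>2 / 2)) ^ Suc n"
proof (induction n)
  case 0
  show ?case
    using nn_integral_lborel_reflect[of "\<lambda>z. ennreal (exp (- v \<bullet> z)) * ennreal (h z)" x0]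
      exp_moment_le[of "- v"]
    by (simp add: inner_diff_right)
next
  case (Suc n)
  have "(\<integral>\<^sup>+x. ennreal (exp (v \<bullet> (x - x0))) * ennreal (h (x - y)) \<partial>lborel) * 1
      \<le> ennreal (exp ((norm v * \<epsilon>)\<^sup>2 / 2)) * ennreal (exp (v \<bullet> (y - x0)))" for y
  proof -
    have "(\<integral>\<^sup>+x. ennreal (exp (v \<bullet> (x - x0))) * ennreal (h (x - y)) \<partial>lborel)
       = (\<integral>\<^sup>+x. ennreal (exp (v \<bullet> (x + y - x0))) * ennreal (h x) \<partial>lborel)"
      using nn_integral_lborel_translate[of "\<lambda>x. ennreal (exp (v \<bullet> (x - x0))) * ennreal (h (x - y))" y]
      by simp
    also have "\<dots> = (\<integral>\<^sup>+x. ennreal (exp (v \<bullet> (y - x0))) * (ennreal (exp (v \<bullet> x)) * ennreal (h x)) \<partial>lborel)"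
    proof (intro nn_integral_cong)
      fix x
      have "v \<bullet> (x + y - x0) = v \<bullet> (y - x0) + v \<bullet> x"
        by (simp add: inner_add_right inner_diff_right)
      then show "ennreal (exp (v \<bullet> (x + y - x0))) * ennreal (h x)
          = ennreal (exp (v \<bullet> (y - x0))) * (ennreal (exp (v \<bullet> x)) * ennreal (h x))"
        by (simp add: exp_add ennreal_mult' mult.assoc)
    qed
    also have "\<dots> = ennreal (exp (v \<bullet> (y - x0))) * (\<integral>\<^sup>+x. ennreal (exp (v \<bullet> x)) * ennreal (h x) \<partial>lborel)"
      by (rule nn_integral_cmult) auto
    finally show ?thesis
      using mult_left_mono[OF exp_moment_le[of v], of "ennreal (exp (v \<bullet> (y - x0)))"]
      by (simp add: mult.commute)
  qed
  then have "(\<integral>\<^sup>+y. ennreal (exp (v \<bullet> (y - x0))) * conv_pow (Suc n) x0 y \<partial>lborel)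
     \<le> ennreal (exp ((norm v * \<epsilon>)\<^sup>2 / 2))
        * (\<integral>\<^sup>+y. ennreal (exp (v \<bullet> (y - x0))) * conv_pow n x0 y \<partial>lborel)"
    unfolding funpow.simps o_def by (intro nn_integral_kernel_op_le) auto
  also have "\<dots> \<le> ennreal (exp ((norm v * \<epsilon>)\<^sup>2 / 2)) * ennreal (exp ((norm v * \<epsilon>)\<^sup>2 / 2)) ^ Suc n"
    by (intro mult_left_mono Suc) auto
  finally show ?case by simp
qed

text \<open>Chernoff's bound. Outside the ball some coordinate of the displacement has modulus at
  least \<open>s / sqrt d\<close>; a union bound over the two signs of each coordinate direction
  gives the factor \<open>2 * d\<close>. The walk has \<open>Suc n \<le> k\<close> steps, so one
  exponent serves all \<open>n < k\<close>.\<close>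

lemma conv_pow_tail:
  assumes "n < k" and "0 \<le> s" and "0 < \<epsilon>"
  shows "(\<integral>\<^sup>+y. indicator (- ball x0 s) y * conv_pow n x0 y \<partial>lborel)
     \<le> ennreal (2 * real DIM('a) * exp (- (s\<^sup>2 / (2 * real DIM('a) * real k * \<epsilon>\<^sup>2))))"
proof -
  define d where "d = real DIM('a)"
  have d: "0 < d" unfolding d_def by simp
  \<comment> \<open>The minimiser of \<open>- l * s / sqrt d + k * (l * \<epsilon>)^2 / 2\<close>,
    the exponent of the Chernoff bound for \<open>k\<close> steps.\<close>
  define l where "l = s / (sqrt d * real k * \<epsilon>\<^sup>2)"
  have k: "0 < real k" using \<open>n < k\<close> by simp
  have l0: "0 \<le> l" unfolding l_def using assms d by simp
  \<comment> \<open>For \<open>v\<close> of the form plus or minus \<open>l *\<^sub>R b\<close>,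
    this majorises the density on the half-space where the displacement in the direction of
    \<open>v\<close> is at least \<open>s / sqrt d\<close>.\<close>
  define F where "F v y = ennreal (exp (- (l * s / sqrt d))) * (ennreal (exp (v \<bullet> (y - x0))) * conv_pow n x0 y)" for v y
  have pointwise: "indicator (- ball x0 s) y * conv_pow n x0 y
      \<le> (\<Sum>b\<in>Basis. F (l *\<^sub>R b) y + F (- (l *\<^sub>R b)) y)" for y
  proof (cases "y \<in> ball x0 s")
    case False
    then have s: "s \<le> norm (y - x0)" by (simp add: dist_norm norm_minus_commute)
    \<comment> \<open>A coordinate of largest modulus is at least the Euclidean norm divided by
      \<open>sqrt d\<close>.\<close>
    have "infnorm (y - x0) \<in> (\<lambda>b. \<bar>(y - x0) \<bullet> b\<bar>) ` Basis"
      unfolding infnorm_Max by (rule Max_in) auto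
    then obtain b where b: "b \<in> Basis" "infnorm (y - x0) = \<bar>(y - x0) \<bullet> b\<bar>" by auto
    have "s \<le> sqrt d * \<bar>(y - x0) \<bullet> b\<bar>"
      using norm_le_infnorm[of "y - x0"] s b(2) unfolding d_def by simp
    then have "s / sqrt d \<le> \<bar>(y - x0) \<bullet> b\<bar>"
      using d by (simp add: field_simps)
    then have "l * (s / sqrt d) \<le> l * \<bar>(y - x0) \<bullet> b\<bar>"
      by (rule mult_left_mono[OF _ l0])
    then have "1 \<le> exp (- (l * s / sqrt d)) * exp ((l *\<^sub>R b) \<bullet> (y - x0))
        \<or> 1 \<le> exp (- (l * s / sqrt d)) * exp ((- (l *\<^sub>R b)) \<bullet> (y - x0))"
      by (auto simp: exp_add[symmetric] inner_commute abs_if split: if_splits)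
    then obtain v where v: "v = l *\<^sub>R b \<or> v = - (l *\<^sub>R b)"
      "1 \<le> exp (- (l * s / sqrt d)) * exp (v \<bullet> (y - x0))" by blast
    have "1 * conv_pow n x0 y \<le> ennreal (exp (- (l * s / sqrt d)) * exp (v \<bullet> (y - x0))) * conv_pow n x0 y"
      using v(2) by (intro mult_right_mono) auto
    then have "conv_pow n x0 y \<le> F v y"
      by (simp add: F_def ennreal_mult mult.assoc)
    also have "\<dots> \<le> F (l *\<^sub>R b) y + F (- (l *\<^sub>R b)) y"
      using v(1) by auto
    also have "\<dots> \<le> (\<Sum>b\<in>Basis. F (l *\<^sub>R b) y + F (- (l *\<^sub>R b)) y)"
      using b(1) by (intro member_le_sum) auto
    finally show ?thesis using False by simp
  qed simp
  have [measurable]: "F v \<in> borel_measurable borel" for v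
    unfolding F_def by measurable
  have F_le: "(\<integral>\<^sup>+y. F v y \<partial>lborel) \<le> ennreal (exp (- (s\<^sup>2 / (2 * d * real k * \<epsilon>\<^sup>2))))"
    if v: "norm v = l" for v
  proof -
    have "(\<integral>\<^sup>+y. F v y \<partial>lborel) = ennreal (exp (- (l * s / sqrt d)))
        * (\<integral>\<^sup>+y. ennreal (exp (v \<bullet> (y - x0))) * conv_pow n x0 y \<partial>lborel)"
      unfolding F_def by (rule nn_integral_cmult) auto
    also have "\<dots> \<le> ennreal (exp (- (l * s / sqrt d))) * ennreal (exp ((l * \<epsilon>)\<^sup>2 / 2)) ^ Suc n"
      using conv_pow_exp_moment[of v x0 n] v by (intro mult_left_mono) auto
    also have "\<dots> = ennreal (exp (- (l * s / sqrt d) + real (Suc n) * ((l * \<epsilon>)\<^sup>2 / 2)))"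
      unfolding exp_add exp_of_nat_mult by (simp add: ennreal_power ennreal_mult')
    also have "\<dots> \<le> ennreal (exp (- (s\<^sup>2 / (2 * d * real k * \<epsilon>\<^sup>2))))"
    proof -
      have "real (Suc n) * ((l * \<epsilon>)\<^sup>2 / 2) \<le> real k * ((l * \<epsilon>)\<^sup>2 / 2)"
        using \<open>n < k\<close> by (intro mult_right_mono) auto
      also have "\<dots> = s\<^sup>2 / (2 * d * real k * \<epsilon>\<^sup>2)"
        using d k \<open>0 < \<epsilon>\<close> by (simp add: l_def field_simps power2_eq_square)
      finally have "real (Suc n) * ((l * \<epsilon>)\<^sup>2 / 2) \<le> s\<^sup>2 / (2 * d * real k * \<epsilon>\<^sup>2)" .
      moreover have "l * s / sqrt d = s\<^sup>2 / (d * real k * \<epsilon>\<^sup>2)"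
        using d by (simp add: l_def power2_eq_square field_simps)
      moreover have "s\<^sup>2 / (d * real k * \<epsilon>\<^sup>2) = 2 * (s\<^sup>2 / (2 * d * real k * \<epsilon>\<^sup>2))"
        by simp
      ultimately show ?thesis
        by (intro ennreal_leI) simp
    qed
    finally show ?thesis .
  qed
  have "(\<integral>\<^sup>+y. indicator (- ball x0 s) y * conv_pow n x0 y \<partial>lborel)
      \<le> (\<integral>\<^sup>+y. (\<Sum>b\<in>Basis. F (l *\<^sub>R b) y + F (- (l *\<^sub>R b)) y) \<partial>lborel)"
    by (rule nn_integral_mono[OF pointwise])
  also have "\<dots> = (\<Sum>b\<in>Basis. (\<integral>\<^sup>+y. F (l *\<^sub>R b) y \<partial>lborel) + (\<integral>\<^sup>+y. F (- (l *\<^sub>R b)) y \<partial>lborel))"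
    by (subst nn_integral_sum) (auto simp: nn_integral_add)
  also have "\<dots> \<le> (\<Sum>b\<in>(Basis::'a set). ennreal (exp (- (s\<^sup>2 / (2 * d * real k * \<epsilon>\<^sup>2))))
      + ennreal (exp (- (s\<^sup>2 / (2 * d * real k * \<epsilon>\<^sup>2)))))"
    using l0 by (intro sum_mono add_mono F_le) auto
  also have "\<dots> = ennreal (2 * d * exp (- (s\<^sup>2 / (2 * d * real k * \<epsilon>\<^sup>2))))"
    by (simp add: d_def mult_2[symmetric] ennreal_mult ennreal_of_nat_eq_real_of_nat ac_simps)
  finally show ?thesis by (simp add: d_def)
qed

section \<open>Pointwise bounds, and the expansion for an abstract weight\<close>

lemma conv_pow_le:
  assumes H: "\<And>z. h z \<le> H"
  shows "conv_pow n x0 x \<le> ennreal H"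
proof (induction n arbitrary: x)
  case 0
  then show ?case using H by (simp add: ennreal_leI)
next
  case (Suc n)
  have "conv_pow (Suc n) x0 x = (\<integral>\<^sup>+y. ennreal (h (x - y)) * conv_pow n x0 y \<partial>lborel)"
    by (simp add: kernel_op_def)
  also have "\<dots> \<le> (\<integral>\<^sup>+y. ennreal (h (x - y)) * ennreal H \<partial>lborel)"
    by (intro nn_integral_mono mult_left_mono Suc) auto
  also have "\<dots> = ennreal H"
    by (subst nn_integral_multc) (auto simp: mass_centered)
  finally show ?case .
qed

text \<open>Up to the first exit the weights are at most \<open>b\<close>, so the mass leaving at
  time \<open>j\<close> is at most \<open>P * b ^ k\<close> times the Gaussian tail of the free
  walk. There are \<open>k\<close> possible exit times, and \<open>H * B\<close> is the cost of
  passing to a pointwise value.\<close>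

lemma leak_le_tail:
  fixes m :: "'a \<Rightarrow> ennreal"
  defines "T k s \<equiv> 2 * real DIM('a) * exp (- (s\<^sup>2 / (2 * real DIM('a) * real k * \<epsilon>\<^sup>2)))"
  assumes [measurable]: "w \<in> borel_measurable borel" "m \<in> borel_measurable borel"
    and H: "\<And>z. h z \<le> H"
    and m: "\<And>y. (\<integral>\<^sup>+x. m x * ennreal (h (x - y)) \<partial>lborel) * w y \<le> m y"
    and wB: "\<And>y. w y \<le> ennreal B * m y" and mP: "\<And>y. m y \<le> ennreal P"
    and b: "\<And>y. y \<in> ball x0 s \<Longrightarrow> w y \<le> ennreal b"
    and pos: "1 \<le> b" "0 \<le> B" "0 \<le> P" "0 \<le> s" "0 < \<epsilon>"
  shows "leak (\<lambda>z. ennreal (h z)) w (ball x0 s) (\<lambda>y. ennreal (h (x0 - y))) k x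
    \<le> ennreal (H * B * P * b ^ k * real k * T k s)"
proof -
  have H0: "0 \<le> H" using H[of 0] nonneg[of 0] by linarith
  let ?h = "\<lambda>z. ennreal (h z)" and ?A = "ball x0 s" and ?g = "\<lambda>y. ennreal (h (x0 - y))"
  have each: "(\<integral>\<^sup>+x. m x * (indicator (- ?A) x * stay ?h w ?A ?g j x) \<partial>lborel)
      \<le> ennreal (P * b ^ k * T k s)" if "j < k" for j
  proof -
    \<comment> \<open>The weights give \<open>b ^ j\<close>, at most \<open>b ^ k\<close> because
      \<open>1 \<le> b\<close>; dropping the restriction to the ball leaves the free walk.\<close>
    have "stay ?h w ?A ?g j y \<le> ennreal (b ^ k) * conv_pow j x0 y" for y
    proof -
      have "stay ?h w ?A ?g j y \<le> ennreal b ^ j * stay ?h (\<lambda>_. 1) ?A ?g j y"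
        by (rule stay_le_power) (use b in auto)
      also have "\<dots> \<le> ennreal (b ^ k) * conv_pow j x0 y"
        using that pos by (intro mult_mono stay_le_iterate) (auto simp: ennreal_power intro!: ennreal_leI power_increasing)
      finally show ?thesis .
    qed
    then have "m y * (indicator (- ?A) y * stay ?h w ?A ?g j y)
        \<le> ennreal P * (indicator (- ?A) y * (ennreal (b ^ k) * conv_pow j x0 y))" for y
      by (intro mult_mono mP) auto
    then have "(\<integral>\<^sup>+x. m x * (indicator (- ?A) x * stay ?h w ?A ?g j x) \<partial>lborel)
       \<le> (\<integral>\<^sup>+y. (ennreal P * ennreal (b ^ k)) * (indicator (- ?A) y * conv_pow j x0 y) \<partial>lborel)"
      by (intro nn_integral_mono) (simp add: ac_simps)
    also have "\<dots> = (ennreal P * ennreal (b ^ k)) * (\<integral>\<^sup>+y. indicator (- ?A) y * conv_pow j x0 y \<partial>lborel)"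
      by (rule nn_integral_cmult) auto
    also have "\<dots> \<le> (ennreal P * ennreal (b ^ k)) * ennreal (T k s)"
      unfolding T_def by (intro mult_left_mono conv_pow_tail that pos) auto
    also have "\<dots> = ennreal (P * b ^ k * T k s)"
      using pos by (simp add: ennreal_mult'[symmetric])
    finally show ?thesis .
  qed
  have "leak ?h w ?A ?g k x \<le> ennreal H * ennreal B
      * (\<Sum>j<k. \<integral>\<^sup>+x. m x * (indicator (- ?A) x * stay ?h w ?A ?g j x) \<partial>lborel)"
    by (rule leak_le) (use m wB H in \<open>auto intro!: ennreal_leI\<close>)
  also have "\<dots> \<le> ennreal H * ennreal B * (\<Sum>j<k. ennreal (P * b ^ k * T k s))"
    by (intro mult_left_mono sum_mono each) auto
  also have "\<dots> = ennreal (H * B * P * b ^ k * real k * T k s)"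
    using pos H0 by (simp add: T_def ennreal_mult'[symmetric] ennreal_of_nat_eq_real_of_nat ac_simps)
  finally show ?thesis .
qed

text \<open>Both the weighted iterate and the free one are split into staying and leaking paths. The
  staying parts differ by a factor between \<open>a ^ k\<close> and \<open>b ^ k\<close>, which
  becomes \<open>1 + E1\<close>; the two leaks make up \<open>E2\<close>.\<close>

lemma iterate_expansion:
  fixes m :: "'a \<Rightarrow> ennreal"
  defines "T k s \<equiv> 2 * real DIM('a) * exp (- (s\<^sup>2 / (2 * real DIM('a) * real k * \<epsilon>\<^sup>2)))"
  assumes [measurable]: "w \<in> borel_measurable borel" "m \<in> borel_measurable borel"
    and H: "\<And>z. h z \<le> H"
    and m: "\<And>y. (\<integral>\<^sup>+x. m x * ennreal (h (x - y)) \<partial>lborel) * w y \<le> m y"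
    and wB: "\<And>y. w y \<le> ennreal B * m y" and mP: "\<And>y. m y \<le> ennreal P"
    and b: "\<And>y. y \<in> ball x0 s \<Longrightarrow> w y \<le> ennreal b"
    and a: "\<And>y. y \<in> ball x0 s \<Longrightarrow> ennreal a \<le> w y"
    and pos: "0 \<le> a" "a \<le> 1" "1 \<le> b" "0 \<le> B" "0 \<le> P" "0 \<le> s" "0 < \<epsilon>"
  shows "\<exists>E1 E2. enn2real ((kernel_op (\<lambda>z. ennreal (h z)) w ^^ k) (\<lambda>y. ennreal (h (x0 - y))) x)
       = (1 + E1) * enn2real (conv_pow k x0 x) + E2
     \<and> a ^ k \<le> 1 + E1 \<and> 1 + E1 \<le> b ^ k
     \<and> \<bar>E2\<bar> \<le> H * (B * P + 1) * b ^ k * real k * T k s"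
proof -
  have H0: "0 \<le> H" using H[of 0] nonneg[of 0] by linarith
  let ?h = "\<lambda>z. ennreal (h z)" and ?A = "ball x0 s" and ?g = "\<lambda>y. ennreal (h (x0 - y))"
  define V where "V = stay ?h w ?A ?g k x"
  define V' where "V' = stay ?h (\<lambda>_. 1) ?A ?g k x"
  define Q where "Q = leak ?h w ?A ?g k x"
  define Q' where "Q' = leak ?h (\<lambda>_. 1) ?A ?g k x"
  have T0: "0 \<le> T k s" by (simp add: T_def)
  have decomp: "(kernel_op ?h w ^^ k) ?g x = V + Q" "conv_pow k x0 x = V' + Q'"
    unfolding V_def V'_def Q_def Q'_def by (subst iterate_eq_stay_plus_leak[where A = ?A]; simp)+
  have Q: "Q \<le> ennreal (H * B * P * b ^ k * real k * T k s)"
    unfolding Q_def T_def by (rule leak_le_tail[where m = m]) (use assms in auto)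
  \<comment> \<open>The free walk is the case of weight one, which conserves Lebesgue mass:
    \<open>m\<close>, \<open>B\<close>, \<open>P\<close> and \<open>b\<close> are all 1.\<close>
  have Q': "Q' \<le> ennreal (H * 1 * 1 * 1 ^ k * real k * T k s)"
    unfolding Q'_def T_def by (rule leak_le_tail[where m = "\<lambda>_. 1"])
      (use pos H in \<open>auto simp: mass_centered'\<close>)
  have VV': "ennreal a ^ k * V' \<le> V" "V \<le> ennreal b ^ k * V'"
    unfolding V_def V'_def by (rule power_le_stay stay_le_power; use a b in auto)+
  \<comment> \<open>Finiteness of \<open>V'\<close> carries over to \<open>V\<close>; with the
    bounds on the leaks all four quantities can be treated as reals.\<close>
  have "V' \<le> ennreal H"
    unfolding V'_def by (rule order_trans[OF stay_le_iterate conv_pow_le[OF H]]) auto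
  then obtain v' where v': "V' = ennreal v'" "0 \<le> v'"
    by (cases V') (auto simp: top_unique)
  have v_le: "V \<le> ennreal (b ^ k * v')"
    using VV'(2) v' pos by (simp add: ennreal_power ennreal_mult)
  then obtain v where v: "V = ennreal v" "0 \<le> v"
    by (cases V) (auto simp: top_unique)
  from Q obtain q where q: "Q = ennreal q" "0 \<le> q"
    by (cases Q) (auto simp: top_unique)
  from Q' obtain q' where q': "Q' = ennreal q'" "0 \<le> q'"
    by (cases Q') (auto simp: top_unique)
  have vb: "v \<le> b ^ k * v'"
    using v_le v v' pos by simp
  have "ennreal (a ^ k * v') \<le> ennreal v"
    using VV'(1) v v' pos by (simp add: ennreal_power ennreal_mult)
  then have va: "a ^ k * v' \<le> v"
    using v by simp
  have qb: "q \<le> H * B * P * b ^ k * real k * T k s"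
    using Q q pos H0 T0 by simp
  have qb': "q' \<le> H * real k * T k s"
    using Q' q' pos H0 T0 by simp
  have ab: "a ^ k \<le> 1" "1 \<le> b ^ k"
    using pos by (auto intro: power_le_one one_le_power)
  \<comment> \<open>If \<open>v' = 0\<close> then \<open>v = 0\<close> as well by \<open>vb\<close>,
    and any value between \<open>a ^ k\<close> and \<open>b ^ k\<close> would do; 1 is one of
    them.\<close>
  define \<theta> where "\<theta> = (if v' = 0 then 1 else v / v')"
  have \<theta>: "a ^ k \<le> \<theta>" "\<theta> \<le> b ^ k" "v = \<theta> * v'"
    using va vb v v' ab by (auto simp: \<theta>_def field_simps)
  have \<theta>0: "0 \<le> \<theta>" using \<theta>(1) pos by (meson order_trans zero_le_power)
  show ?thesis
  proof (intro exI conjI)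
    \<comment> \<open>The leading term contains the whole free density and not only its staying
      part, so \<theta> times the free leak has to be subtracted again.\<close>
    show "enn2real ((kernel_op ?h w ^^ k) ?g x) = (1 + (\<theta> - 1)) * enn2real (conv_pow k x0 x) + (q - \<theta> * q')"
      unfolding decomp v v' q q' using v v' q q' \<theta>(3)
      by (simp add: ennreal_plus[symmetric] algebra_simps del: ennreal_plus)
    have "\<theta> * q' \<le> b ^ k * (H * real k * T k s)"
      using \<theta> \<theta>0 qb' q' by (intro mult_mono) auto
    moreover have "\<bar>q - \<theta> * q'\<bar> \<le> q + \<theta> * q'"
      using q(2) \<theta>0 q'(2) by (simp add: abs_le_iff)
    ultimately show "\<bar>q - \<theta> * q'\<bar> \<le> H * (B * P + 1) * b ^ k * real k * T k s"
      using qb by (simp add: algebra_simps)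
  qed (use \<theta> in auto)
qed

end

section \<open>From operators on extended nonnegative functions to real integrals\<close>

lemma (in step_kernel) conv_pow_translate: "conv_pow n x0 x = conv_pow n 0 (x - x0)"
proof (induction n arbitrary: x)
  case 0
  then show ?case using even[of "x - x0"] by simp
next
  case (Suc n)
  have "conv_pow (Suc n) x0 x = (\<integral>\<^sup>+y. ennreal (h (x - y)) * conv_pow n 0 (y - x0) \<partial>lborel)"
    by (simp add: kernel_op_def[of _ _ "conv_pow n x0"] Suc)
  also have "\<dots> = (\<integral>\<^sup>+y. ennreal (h (x - x0 - (y - x0))) * conv_pow n 0 (y - x0) \<partial>lborel)"
    by simp
  also have "\<dots> = (\<integral>\<^sup>+y. ennreal (h (x - x0 - y)) * conv_pow n 0 y \<partial>lborel)"
    using nn_integral_lborel_translate[of "\<lambda>y. ennreal (h (x - x0 - y)) * conv_pow n 0 y" "- x0"] by simp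
  also have "\<dots> = conv_pow (Suc n) 0 (x - x0)"
    unfolding funpow.simps o_def by (subst kernel_op_def) simp
  finally show ?case .
qed

text \<open>Boundedness of the factors against a kernel of mass one ensures integrability, so the
  Bochner integral is the true value and not the default 0.\<close>

lemma (in step_kernel) ennreal_integral_kernel:
  assumes [measurable]: "w \<in> borel_measurable borel" "f \<in> borel_measurable borel"
    and w: "\<And>y. 0 \<le> w y" "\<And>y. w y \<le> W" and f: "\<And>y. 0 \<le> f y" "\<And>y. f y \<le> K"
  shows "ennreal (LINT y|lborel. h (x - y) * (w y * f y))
      = kernel_op (\<lambda>z. ennreal (h z)) (\<lambda>y. ennreal (w y)) (\<lambda>y. ennreal (f y)) x"
    and "(LINT y|lborel. h (x - y) * (w y * f y)) \<le> W * K"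
    and "integrable lborel (\<lambda>y. h (x - y) * (w y * f y))"
proof -
  have WK: "0 \<le> W" "0 \<le> K" using w[of 0] f[of 0] by linarith+
  have eq: "(\<integral>\<^sup>+y. ennreal (h (x - y) * (w y * f y)) \<partial>lborel)
      = kernel_op (\<lambda>z. ennreal (h z)) (\<lambda>y. ennreal (w y)) (\<lambda>y. ennreal (f y)) x"
    unfolding kernel_op_def using nonneg w f by (simp add: ennreal_mult)
  have "(\<integral>\<^sup>+y. ennreal (h (x - y) * (w y * f y)) \<partial>lborel)
     \<le> (\<integral>\<^sup>+y. ennreal (h (x - y)) * ennreal (W * K) \<partial>lborel)"
    using nonneg w f WK
    by (intro nn_integral_mono) (auto simp: ennreal_mult'[symmetric] intro!: ennreal_leI mult_left_mono mult_mono)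
  also have "\<dots> = ennreal (W * K)"
    by (subst nn_integral_multc) (auto simp: mass_centered)
  finally have le: "(\<integral>\<^sup>+y. ennreal (h (x - y) * (w y * f y)) \<partial>lborel) \<le> ennreal (W * K)" .
  show int: "integrable lborel (\<lambda>y. h (x - y) * (w y * f y))"
    using le nonneg w f by (intro integrableI_nonneg) (auto simp: top_unique less_top[symmetric])
  have "(\<integral>\<^sup>+y. ennreal (h (x - y) * (w y * f y)) \<partial>lborel)
      = ennreal (LINT y|lborel. h (x - y) * (w y * f y))"
    using nonneg w f by (intro nn_integral_eq_integral int) auto
  with eq show ennreal_eq: "ennreal (LINT y|lborel. h (x - y) * (w y * f y))
      = kernel_op (\<lambda>z. ennreal (h z)) (\<lambda>y. ennreal (w y)) (\<lambda>y. ennreal (f y)) x"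
    by simp
  show "(LINT y|lborel. h (x - y) * (w y * f y)) \<le> W * K"
    using le unfolding eq ennreal_eq[symmetric] using WK by (subst (asm) ennreal_le_iff) auto
qed

text \<open>The operator \<open>F\<close> is specified only by its formula, so that both the
  averaging operator and the convolution fit. The induction carries measurability and the bound
  \<open>W ^ n * K\<close>, which make the next integral legitimate.\<close>

lemma (in step_kernel) ennreal_iterate:
  assumes [measurable]: "w \<in> borel_measurable borel" "g \<in> borel_measurable borel"
    and w: "\<And>y. 0 \<le> w y" "\<And>y. w y \<le> W" and g: "\<And>y. 0 \<le> g y" "\<And>y. g y \<le> K"
    and F: "\<And>f x. F f x = (LINT y|lborel. h (x - y) * (w y * f y))"
  shows "(F ^^ n) g x = enn2real ((kernel_op (\<lambda>z. ennreal (h z)) (\<lambda>y. ennreal (w y)) ^^ n) (\<lambda>y. ennreal (g y)) x)"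
proof -
  have "(F ^^ n) g \<in> borel_measurable borel \<and>
     (\<forall>x. 0 \<le> (F ^^ n) g x \<and> (F ^^ n) g x \<le> W ^ n * K) \<and>
     (\<lambda>x. ennreal ((F ^^ n) g x))
       = (kernel_op (\<lambda>z. ennreal (h z)) (\<lambda>y. ennreal (w y)) ^^ n) (\<lambda>y. ennreal (g y))"
  proof (induction n)
    case 0
    then show ?case using g by simp
  next
    case (Suc n)
    let ?f = "(F ^^ n) g"
    have [measurable]: "?f \<in> borel_measurable borel" and f: "\<And>y. 0 \<le> ?f y" "\<And>y. ?f y \<le> W ^ n * K"
      using Suc by auto
    have step: "(F ^^ Suc n) g = (\<lambda>x. LINT y|lborel. h (x - y) * (w y * ?f y))"
      by (simp add: F fun_eq_iff)
    have "(\<lambda>x. LINT y|lborel. h (x - y) * (w y * ?f y)) \<in> borel_measurable borel"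
      by measurable
    moreover have "0 \<le> (LINT y|lborel. h (x - y) * (w y * ?f y))" for x
      using nonneg w f by (intro integral_nonneg_AE) auto
    ultimately show ?case
      unfolding step using Suc ennreal_integral_kernel[OF _ _ w f]
      by (auto simp: mult.assoc)
  qed
  then have "ennreal ((F ^^ n) g x)
      = (kernel_op (\<lambda>z. ennreal (h z)) (\<lambda>y. ennreal (w y)) ^^ n) (\<lambda>y. ennreal (g y)) x" "0 \<le> (F ^^ n) g x"
    by metis+
  then show ?thesis by (metis enn2real_ennreal)
qed

section \<open>Lipschitz domains and the scaled kernel\<close>

text \<open>A uniform interior corkscrew condition. Near a boundary point, moving from
  \<open>y\<close> by \<open>t / 2\<close> in the upward direction gains enough height for a ball of
  radius proportional to \<open>t\<close> to stay above the graph; compactness of the closure makes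
  the constants uniform.\<close>

lemma lipschitz_boundary_inner_ball:
  fixes \<Omega> :: "'a::euclidean_space set"
  assumes "open \<Omega>" "bounded \<Omega>" "lipschitz_boundary \<Omega>"
  obtains r \<kappa> where "0 < r" "0 < \<kappa>"
    "\<And>y t. y \<in> \<Omega> \<Longrightarrow> 0 < t \<Longrightarrow> t \<le> r \<Longrightarrow> \<exists>z. ball z (\<kappa> * t) \<subseteq> \<Omega> \<inter> ball y t"
proof -
  let ?P = "\<lambda>p r \<kappa>. 0 < r \<and> 0 < \<kappa> \<and>
    (\<forall>y\<in>\<Omega> \<inter> ball p r. \<forall>t. 0 < t \<and> t \<le> r \<longrightarrow> (\<exists>z. ball z (\<kappa> * t) \<subseteq> \<Omega> \<inter> ball y t))"
  have "\<exists>r \<kappa>. ?P p r \<kappa>" if "p \<in> closure \<Omega>" for p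
  proof (cases "p \<in> \<Omega>")
    case True
    then obtain e where e: "0 < e" "ball p e \<subseteq> \<Omega>"
      using \<open>open \<Omega>\<close> by (auto simp: open_contains_ball)
    have "ball y (1 * t) \<subseteq> \<Omega> \<inter> ball y t" if "y \<in> ball p (e / 2)" "t \<le> e / 2" for y t
    proof -
      have "ball y t \<subseteq> ball p e"
        using that by (intro ball_subset_ball_iff[THEN iffD2]) (auto simp: dist_commute)
      with e show ?thesis by auto
    qed
    with e show ?thesis
      by (rule_tac exI[of _ "e / 2"], rule_tac exI[of _ 1]) (meson IntE half_gt_zero zero_less_one)
  next
    case False
    have "p \<in> frontier \<Omega>"
      using False that \<open>open \<Omega>\<close> by (simp add: frontier_def interior_open)
    obtain e u L g where e: "0 < e" and u: "norm u = 1"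
      and g: "L-lipschitz_on {v. v \<bullet> u = 0} (g :: 'a \<Rightarrow> real)"
      and \<Omega>: "\<Omega> \<inter> ball p e = {x \<in> ball p e. x \<bullet> u > g (x - (x \<bullet> u) *\<^sub>R u)}"
      using assms(3)[unfolded lipschitz_boundary_def, rule_format, OF \<open>p \<in> frontier \<Omega>\<close>]
      by (elim exE conjE) (rule that)
    have L: "0 \<le> L" using g by (rule lipschitz_on_nonneg)
    have uu: "u \<bullet> u = 1" using u by (simp add: dot_square_norm)
    \<comment> \<open>The bound by \<open>1 / 4\<close> keeps the small ball inside
      \<open>ball y t\<close>. The bound on \<open>\<kappa> * (2 * L + 1)\<close> makes the height
      gain \<open>t / 2\<close> absorb both the rise of the graph, at most
      \<open>2 * L * norm v\<close>, and the height loss, at most \<open>norm v\<close>.\<close>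
    define \<kappa> where "\<kappa> = 1 / (4 * (1 + L))"
    have \<kappa>: "0 < \<kappa>" "\<kappa> \<le> 1 / 4" "\<kappa> * (2 * L + 1) \<le> 1 / 2"
      using L by (auto simp: \<kappa>_def field_simps)
    have "ball (y + (t / 2) *\<^sub>R u) (\<kappa> * t) \<subseteq> \<Omega> \<inter> ball y t"
      if y: "y \<in> \<Omega>" "y \<in> ball p (e / 2)" and t: "0 < t" "t \<le> e / 2" for y t
    proof
      fix x assume "x \<in> ball (y + (t / 2) *\<^sub>R u) (\<kappa> * t)"
      define v where "v = x - (y + (t / 2) *\<^sub>R u)"
      have x: "x = y + (t / 2) *\<^sub>R u + v" by (simp add: v_def)
      have v: "norm v < \<kappa> * t"
        using \<open>x \<in> _\<close> by (simp add: v_def dist_norm norm_minus_commute)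
      have "norm (x - y) \<le> norm ((t / 2) *\<^sub>R u) + norm v"
        unfolding x using norm_triangle_ineq[of "(t / 2) *\<^sub>R u" v] by simp
      also have "\<dots> < t / 2 + t / 4"
      proof -
        have "\<kappa> * t \<le> 1 / 4 * t" using \<kappa>(2) t by (intro mult_right_mono) auto
        moreover have "norm ((t / 2) *\<^sub>R u) = t / 2" using t u by simp
        ultimately show ?thesis using v by linarith
      qed
      finally have "norm (x - y) < t" using t by simp
      then have xt: "x \<in> ball y t" by (simp add: dist_norm norm_minus_commute)
      \<comment> \<open>The graph describes \<Omega> only inside \<open>ball p e\<close>; this is
        why \<open>y\<close> and \<open>t\<close> are restricted to half of
        \<open>e\<close>.\<close>
      have "dist p x < e"
        using dist_triangle[of p x y] y xt t by simp
      then have xe: "x \<in> ball p e" by simp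
      \<comment> \<open>The orthogonal projection onto the hyperplane on which \<open>g\<close>
        lives; the crude bound \<open>2 * norm v\<close> for the horizontal displacement
        suffices.\<close>
      define \<pi> where "\<pi> z = z - (z \<bullet> u) *\<^sub>R u" for z
      have \<pi>_orth: "\<pi> z \<in> {v. v \<bullet> u = 0}" for z
        by (simp add: \<pi>_def inner_diff_left uu)
      have "\<pi> x - \<pi> y = v - (v \<bullet> u) *\<^sub>R u"
        by (simp add: \<pi>_def x inner_add_left uu algebra_simps)
      then have "dist (\<pi> x) (\<pi> y) \<le> norm v + \<bar>v \<bullet> u\<bar>"
        using norm_triangle_ineq4[of v "(v \<bullet> u) *\<^sub>R u"] u by (simp add: dist_norm)
      moreover have vu: "\<bar>v \<bullet> u\<bar> \<le> norm v"
        using Cauchy_Schwarz_ineq2[of v u] u by simp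
      ultimately have "dist (\<pi> x) (\<pi> y) \<le> 2 * norm v" by linarith
      then have "L * dist (\<pi> x) (\<pi> y) \<le> L * (2 * norm v)"
        by (rule mult_left_mono[OF _ L])
      with lipschitz_onD[OF g \<pi>_orth \<pi>_orth, of x y]
      have g_le: "g (\<pi> x) \<le> g (\<pi> y) + 2 * L * norm v"
        by (auto simp: dist_real_def)
      have "y \<in> \<Omega> \<inter> ball p e" using y e by auto
      then have gy: "g (\<pi> y) < y \<bullet> u" unfolding \<Omega> by (simp add: \<pi>_def)
      have "(2 * L + 1) * norm v \<le> (2 * L + 1) * (\<kappa> * t)"
        using v L by (intro mult_left_mono) auto
      also have "\<dots> \<le> t / 2"
        using mult_right_mono[OF \<kappa>(3), of t] t by (simp add: ac_simps)
      finally have "2 * L * norm v + norm v \<le> t / 2" by (simp add: algebra_simps)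
      moreover have "x \<bullet> u = y \<bullet> u + t / 2 + v \<bullet> u"
        by (simp add: x inner_add_left uu)
      ultimately have "g (\<pi> x) < x \<bullet> u"
        using g_le gy vu by linarith
      then have "x \<in> \<Omega> \<inter> ball p e"
        unfolding \<Omega> using xe by (simp add: \<pi>_def)
      with xt show "x \<in> \<Omega> \<inter> ball y t" by blast
    qed
    with e \<kappa> show ?thesis
      by (rule_tac exI[of _ "e / 2"], rule_tac exI[of _ \<kappa>]) (meson IntE half_gt_zero)
  qed
  then obtain r \<kappa> where P: "\<And>p. p \<in> closure \<Omega> \<Longrightarrow> ?P p (r p) (\<kappa> p)" by metis
  have "compact (closure \<Omega>)" using \<open>bounded \<Omega>\<close> by simp
  moreover have "closure \<Omega> \<subseteq> (\<Union>p\<in>closure \<Omega>. ball p (r p))"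
    using P by force
  ultimately obtain D where D: "D \<subseteq> closure \<Omega>" "finite D" "closure \<Omega> \<subseteq> (\<Union>p\<in>D. ball p (r p))"
    using compactE_image[of "closure \<Omega>" "closure \<Omega>" "\<lambda>p. ball p (r p)"] by (metis open_ball)
  \<comment> \<open>The inserted 1 keeps both minima meaningful when \<open>D\<close> is
    empty.\<close>
  define r0 where "r0 = Min (insert 1 (r ` D))"
  define \<kappa>0 where "\<kappa>0 = Min (insert 1 (\<kappa> ` D))"
  have "0 < r0" "0 < \<kappa>0"
    unfolding r0_def \<kappa>0_def using D P by (auto simp: subset_iff)
  moreover have "\<exists>z. ball z (\<kappa>0 * t) \<subseteq> \<Omega> \<inter> ball y t" if y: "y \<in> \<Omega>" and t: "0 < t" "t \<le> r0" for y t
  proof -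
    obtain p where p: "p \<in> D" "y \<in> ball p (r p)"
      using y D(3) closure_subset[of \<Omega>] by blast
    have "r0 \<le> r p" "\<kappa>0 \<le> \<kappa> p"
      unfolding r0_def \<kappa>0_def using p D(2) by auto
    then obtain z where "ball z (\<kappa> p * t) \<subseteq> \<Omega> \<inter> ball y t"
      using P[of p] p D(1) y t by (meson IntI order_trans subsetD)
    moreover have "ball z (\<kappa>0 * t) \<subseteq> ball z (\<kappa> p * t)"
      using \<open>\<kappa>0 \<le> \<kappa> p\<close> t by (intro subset_ball mult_right_mono) auto
    ultimately show ?thesis by blast
  qed
  ultimately show ?thesis by (rule that)
qed

text \<open>Measurability comes from monotonicity of the profile, the mass from the change of
  variables \<open>z = \<epsilon> *\<^sub>R x\<close>, and symmetry from radiality.\<close>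

lemma step_kernel_scaled_kernel:
  fixes \<eta> :: "real \<Rightarrow> real"
  assumes \<eta>_nonneg: "\<And>t. 0 \<le> t \<Longrightarrow> 0 \<le> \<eta> t"
    and \<eta>_noninc: "antimono_on {0..} \<eta>"
    and \<eta>_supp: "closure {t. 0 \<le> t \<and> \<eta> t \<noteq> 0} \<subseteq> {0..1}"
    and \<eta>_mass: "(LINT z:ball (0::'a::euclidean_space) 1|lborel. \<eta> (norm z)) = 1"
    and \<epsilon>: "0 < \<epsilon>"
  shows "step_kernel (\<lambda>z::'a. scaled_kernel DIM('a) \<eta> \<epsilon> (norm z)) \<epsilon>"
proof -
  \<comment> \<open>The profile is controlled on the half-line only; composing with
    \<open>max 0\<close> makes it monotone on all reals without changing it at norms.\<close>
  have "mono (\<lambda>t. - \<eta> (max 0 t))"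
    using \<eta>_noninc by (auto simp: mono_def monotone_on_def)
  then have "(\<lambda>t. - (- \<eta> (max 0 t))) \<in> borel_measurable borel"
    by (intro borel_measurable_uminus borel_measurable_mono)
  then have [measurable]: "(\<lambda>t. \<eta> (max 0 t)) \<in> borel_measurable borel" by simp
  have "(\<lambda>z::'a. \<eta> (max 0 (norm z))) \<in> borel_measurable borel" by measurable
  then have meas1 [measurable]: "(\<lambda>z::'a. \<eta> (norm z)) \<in> borel_measurable borel" by simp
  have vanish: "\<eta> t = 0" if "1 < t" for t
  proof (rule ccontr)
    assume "\<eta> t \<noteq> 0"
    then have "t \<in> closure {t. 0 \<le> t \<and> \<eta> t \<noteq> 0}"
      using that closure_subset by fastforce
    with \<eta>_supp that show False by auto
  qed
  \<comment> \<open>The mass is normalised on the open ball, but \<open>\<eta> 1\<close> may be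
    nonzero; the unit sphere is a null set.\<close>
  define S where "S = sphere (0::'a) 1"
  have "S \<in> null_sets lborel"
    unfolding S_def using negligible_sphere[of "0::'a" 1]
    by (auto simp: null_sets_completion_iff negligible_iff_null_sets)
  then have AE: "AE z in lborel. z \<notin> S" by (rule AE_not_in)
  have "(LINT z|lborel. indicator (ball 0 1) z * \<eta> (norm (z::'a))) = 1"
    using \<eta>_mass by (simp add: set_lebesgue_integral_def)
  \<comment> \<open>A non-integrable function would have integral 0 by convention, not 1.\<close>
  moreover from this have "integrable lborel (\<lambda>z::'a. indicator (ball 0 1) z * \<eta> (norm z))"
    by (metis not_integrable_integral_eq zero_neq_one)
  ultimately have "(\<integral>\<^sup>+z. ennreal (indicator (ball 0 1) z * \<eta> (norm (z::'a))) \<partial>lborel) = 1"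
    using \<eta>_nonneg by (subst nn_integral_eq_integral) auto
  moreover have "(\<integral>\<^sup>+z. ennreal (indicator (ball 0 1) z * \<eta> (norm (z::'a))) \<partial>lborel)
      = (\<integral>\<^sup>+z. ennreal (\<eta> (norm (z::'a))) \<partial>lborel)"
    using AE by (intro nn_integral_cong_AE, eventually_elim) (auto simp: S_def indicator_def vanish)
  ultimately have mass1: "(\<integral>\<^sup>+z. ennreal (\<eta> (norm (z::'a))) \<partial>lborel) = 1" by simp
  have scale: "lborel = density (distr lborel borel (\<lambda>x::'a. 0 + \<epsilon> *\<^sub>R x)) (\<lambda>_. \<bar>\<epsilon>\<bar> ^ DIM('a))"
    by (rule lborel_affine) (use \<epsilon> in simp)
  define h where "h z = scaled_kernel DIM('a) \<eta> \<epsilon> (norm z)" for z :: 'a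
  have "(\<lambda>z. \<eta> (norm ((1 / \<epsilon>) *\<^sub>R z)) / \<epsilon> ^ DIM('a)) \<in> borel_measurable (borel :: 'a measure)"
    by measurable
  then have h_meas [measurable]: "h \<in> borel_measurable borel"
    using \<epsilon> by (simp add: h_def[abs_def] scaled_kernel_def)
  have "(\<integral>\<^sup>+z. ennreal (h z) \<partial>lborel)
      = (\<integral>\<^sup>+z. ennreal (h z) \<partial>density (distr lborel borel (\<lambda>x::'a. 0 + \<epsilon> *\<^sub>R x)) (\<lambda>_. \<bar>\<epsilon>\<bar> ^ DIM('a)))"
    by (simp only: scale[symmetric])
  also have "\<dots> = (\<integral>\<^sup>+x. ennreal (\<bar>\<epsilon>\<bar> ^ DIM('a)) * ennreal (h (\<epsilon> *\<^sub>R x)) \<partial>lborel)"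
    by (subst nn_integral_density) (auto simp: nn_integral_distr)
  also have "\<dots> = (\<integral>\<^sup>+x. ennreal (\<eta> (norm (x::'a))) \<partial>lborel)"
    using \<epsilon> \<eta>_nonneg
    by (intro nn_integral_cong) (simp add: h_def scaled_kernel_def ennreal_mult'[symmetric])
  finally have h_mass: "(\<integral>\<^sup>+z. ennreal (h z) \<partial>lborel) = 1" by (simp add: mass1)
  have "step_kernel h \<epsilon>"
  proof
    fix z
    show "0 \<le> h z" using \<epsilon> \<eta>_nonneg by (simp add: h_def scaled_kernel_def)
    show "h (- z) = h z" by (simp add: h_def)
    show "norm z \<le> \<epsilon>" if "h z \<noteq> 0"
    proof (rule ccontr)
      assume "\<not> norm z \<le> \<epsilon>"
      then have "\<eta> (norm z / \<epsilon>) = 0" using \<epsilon> by (intro vanish) simp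
      with that show False by (simp add: h_def scaled_kernel_def)
    qed
  qed (use h_mass in auto)
  then show ?thesis by (simp add: h_def[abs_def])
qed

section \<open>Averages of differentiable functions\<close>

lemma GDERIV_unique:
  assumes "GDERIV f x :> D" "GDERIV f x :> D'"
  shows "D = D'"
proof -
  have "(\<lambda>h. h \<bullet> D) = (\<lambda>h. h \<bullet> D')"
    using assms unfolding gderiv_def by (rule has_derivative_unique)
  then have "(D - D') \<bullet> D = (D - D') \<bullet> D'" by metis
  then have "(D - D') \<bullet> (D - D') = 0" by (simp add: inner_diff_right)
  then show ?thesis by simp
qed

lemma GDERIV_grad:
  assumes "GDERIV f x :> D"
  shows "GDERIV f x :> grad f x"
  using assms theI[of "\<lambda>D. GDERIV f x :> D"] GDERIV_unique unfolding grad_def by metis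

lemma grad_diff_le:
  assumes "C1_holder \<alpha> \<Omega> f" "x \<in> \<Omega>" "y \<in> \<Omega>"
  shows "norm (grad f x - grad f y) \<le> grad_seminorm \<alpha> \<Omega> f * norm (x - y) powr \<alpha>"
proof (cases "x = y")
  case False
  then have "norm (grad f x - grad f y) / norm (x - y) powr \<alpha> \<le> grad_seminorm \<alpha> \<Omega> f"
    unfolding grad_seminorm_def using assms
    by (intro cSup_upper) (auto simp: grad_quotients_def C1_holder_def)
  with False show ?thesis by (simp add: pos_divide_le_eq)
qed simp

text \<open>Two distinct points of \<Omega> are needed, since the supremum of an empty set of
  quotients says nothing; openness supplies a second point.\<close>

lemma grad_seminorm_nonneg:
  fixes \<Omega> :: "'a::euclidean_space set"
  assumes "C1_holder \<alpha> \<Omega> f" "open \<Omega>" "\<Omega> \<noteq> {}"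
  shows "0 \<le> grad_seminorm \<alpha> \<Omega> f"
proof -
  obtain x e where x: "x \<in> \<Omega>" "0 < e" "ball x e \<subseteq> \<Omega>"
    using assms by (metis all_not_in_conv open_contains_ball)
  obtain b :: 'a where b: "b \<in> Basis" using nonempty_Basis by blast
  define y where "y = x + (e / 2) *\<^sub>R b"
  have nxy: "norm (x - y) = e / 2" using x b by (simp add: y_def)
  then have "y \<in> \<Omega>" using x by (auto simp: dist_norm)
  from grad_diff_le[OF assms(1) x(1) this]
  have "0 \<le> grad_seminorm \<alpha> \<Omega> f * norm (x - y) powr \<alpha>"
    by (rule order_trans[OF norm_ge_zero])
  moreover have "0 < norm (x - y) powr \<alpha>" unfolding nxy using x(2) by simp
  ultimately show ?thesis by (simp add: zero_le_mult_iff)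
qed

text \<open>The mean value theorem along the segment gives the gradient at an intermediate point,
  whose distance to \<open>y\<close> is at most \<open>norm (x - y)\<close>; the Hoelder bound
  controls the change of gradient.\<close>

lemma first_order_expansion:
  assumes C1: "C1_holder \<alpha> \<Omega> f" and seg: "closed_segment y x \<subseteq> \<Omega>" and "0 < \<alpha>"
    and G: "0 \<le> grad_seminorm \<alpha> \<Omega> f"
  shows "\<bar>f x - f y - (x - y) \<bullet> grad f y\<bar> \<le> grad_seminorm \<alpha> \<Omega> f * norm (x - y) powr (1 + \<alpha>)"
proof -
  define p where "p t = y + t *\<^sub>R (x - y)" for t
  have p: "p t \<in> \<Omega>" if "0 \<le> t" "t \<le> 1" for t
  proof -
    have "p t = (1 - t) *\<^sub>R y + t *\<^sub>R x" by (simp add: p_def algebra_simps)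
    then show ?thesis using seg that unfolding in_segment subset_iff by blast
  qed
  have "\<exists>t\<in>{0..1}. f (p 1) - f (p 0) = (\<lambda>s. s * ((x - y) \<bullet> grad f (p t))) (1 - 0)"
  proof (rule mvt_very_simple)
    fix t :: real assume t: "0 \<le> t" "t \<le> 1"
    have "GDERIV f (p t) :> grad f (p t)"
      using C1 p[OF t] GDERIV_grad unfolding C1_holder_def by blast
    then have "(f has_derivative (\<lambda>v. v \<bullet> grad f (p t))) (at (p t))"
      by (simp add: gderiv_def)
    moreover have "(p has_derivative (\<lambda>s. s *\<^sub>R (x - y))) (at t within {0..1})"
      unfolding p_def by (auto intro!: derivative_eq_intros)
    ultimately have "((\<lambda>t. f (p t)) has_derivative (\<lambda>s. (s *\<^sub>R (x - y)) \<bullet> grad f (p t))) (at t within {0..1})"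
      by (rule has_derivative_compose[rotated])
    then show "((\<lambda>t. f (p t)) has_derivative (\<lambda>s. s * ((x - y) \<bullet> grad f (p t)))) (at t within {0..1})"
      by simp
  qed simp
  then obtain t where t: "0 \<le> t" "t \<le> 1" and eq: "f x - f y = (x - y) \<bullet> grad f (p t)"
    by (auto simp: p_def)
  have y: "y \<in> \<Omega>" using seg by auto
  have "\<bar>f x - f y - (x - y) \<bullet> grad f y\<bar> = \<bar>(x - y) \<bullet> (grad f (p t) - grad f y)\<bar>"
    by (simp add: eq inner_diff_right)
  also have "\<dots> \<le> norm (x - y) * norm (grad f (p t) - grad f y)"
    by (rule Cauchy_Schwarz_ineq2)
  also have "\<dots> \<le> norm (x - y) * (grad_seminorm \<alpha> \<Omega> f * norm (p t - y) powr \<alpha>)"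
    by (intro mult_left_mono grad_diff_le[OF C1 p[OF t] y]) auto
  also have "\<dots> \<le> norm (x - y) * (grad_seminorm \<alpha> \<Omega> f * norm (x - y) powr \<alpha>)"
    using t G \<open>0 < \<alpha>\<close>
    by (intro mult_left_mono powr_mono2) (auto simp: p_def mult_left_le_one_le)
  also have "\<dots> = grad_seminorm \<alpha> \<Omega> f * norm (x - y) powr (1 + \<alpha>)"
    by (cases "x = y") (auto simp: powr_add)
  finally show ?thesis .
qed

text \<open>The kernel at \<open>y\<close> lives in \<open>cball y \<epsilon>\<close>, hence inside
  \<Omega>, so a full first-order expansion is available there. Its linear term is odd about
  \<open>y\<close> and integrates to zero; only the Hoelder remainder survives.\<close>

lemma (in step_kernel) kernel_average_close:
  fixes f :: "'a \<Rightarrow> real"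
  assumes C1: "C1_holder \<alpha> \<Omega> f" and "0 < \<alpha>" and G: "0 \<le> grad_seminorm \<alpha> \<Omega> f"
    and sub: "cball y \<epsilon> \<subseteq> \<Omega>"
    and [measurable]: "(\<lambda>x. indicator \<Omega> x * f x) \<in> borel_measurable borel"
    and bound: "\<And>x. x \<in> \<Omega> \<Longrightarrow> \<bar>f x\<bar> \<le> P"
  shows "\<bar>(LINT x|lborel. h (y - x) * (indicator \<Omega> x * f x)) - f y\<bar>
    \<le> grad_seminorm \<alpha> \<Omega> f * \<epsilon> powr (1 + \<alpha>)"
proof -
  define G where "G = grad_seminorm \<alpha> \<Omega> f"
  define f' where "f' x = indicator \<Omega> x * f x" for x
  have [measurable]: "f' \<in> borel_measurable borel" unfolding f'_def by measurable
  have y: "y \<in> \<Omega>" using sub eps_nonneg by auto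
  have f': "\<bar>f' x\<bar> \<le> P" for x
    using bound[of x] bound[OF y] by (auto simp: f'_def indicator_def)
  have int_h: "integrable lborel (\<lambda>x. h (y - x))"
    using nonneg mass_centered by (intro integrableI_nonneg) auto
  have h_int: "(LINT x|lborel. h (y - x)) = 1"
    using nonneg mass_centered by (subst integral_eq_nn_integral) auto
  \<comment> \<open>A bound on the support of the kernel is enough; the linear term is not bounded
    on the whole space.\<close>
  have bounded_int: "integrable lborel (\<lambda>x. h (y - x) * q x)"
    if [measurable]: "q \<in> borel_measurable borel"
      and q: "\<And>x. norm (x - y) \<le> \<epsilon> \<Longrightarrow> \<bar>q x\<bar> \<le> Q" for q Q
  proof (rule Bochner_Integration.integrable_bound)
    show "integrable lborel (\<lambda>x. h (y - x) * Q)" using int_h by simp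
    show "AE x in lborel. norm (h (y - x) * q x) \<le> norm (h (y - x) * Q)"
    proof (rule AE_I2)
      fix x
      show "norm (h (y - x) * q x) \<le> norm (h (y - x) * Q)"
        using support[of "y - x"] q[of x] abs_ge_self[of Q]
        by (cases "h (y - x) = 0") (auto simp: abs_mult norm_minus_commute intro!: mult_left_mono)
    qed
  qed auto
  have i1: "integrable lborel (\<lambda>x. h (y - x) * f' x)"
    by (rule bounded_int) (auto intro: f')
  have i2: "integrable lborel (\<lambda>x. h (y - x) * ((x - y) \<bullet> grad f y))"
  proof (rule bounded_int)
    fix x assume "norm (x - y) \<le> \<epsilon>"
    then show "\<bar>(x - y) \<bullet> grad f y\<bar> \<le> \<epsilon> * norm (grad f y)"
      using Cauchy_Schwarz_ineq2[of "x - y" "grad f y"] mult_right_mono norm_ge_zero order_trans by blast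
  qed simp
  \<comment> \<open>The reflection \<open>x\<close> to \<open>2 *\<^sub>R y - x\<close> shows that
    the integral equals its own negative.\<close>
  have "(LINT x|lborel. h (y - x) * ((x - y) \<bullet> grad f y))
      = (LINT x|lborel. h (y - (2 *\<^sub>R y - x)) * (((2 *\<^sub>R y - x) - y) \<bullet> grad f y))"
    by (rule integral_lborel_reflect[symmetric]) measurable
  also have "\<dots> = (LINT x|lborel. - (h (y - x) * ((x - y) \<bullet> grad f y)))"
  proof (rule Bochner_Integration.integral_cong)
    fix x
    have "y - (2 *\<^sub>R y - x) = - (y - x)" "(2 *\<^sub>R y - x) - y = - (x - y)"
      by (simp_all add: scaleR_2)
    then show "h (y - (2 *\<^sub>R y - x)) * (((2 *\<^sub>R y - x) - y) \<bullet> grad f y)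
        = - (h (y - x) * ((x - y) \<bullet> grad f y))"
      by (simp only: even inner_minus_left mult_minus_right)
  qed simp
  also have "\<dots> = - (LINT x|lborel. h (y - x) * ((x - y) \<bullet> grad f y))"
    by simp
  finally have odd0: "(LINT x|lborel. h (y - x) * ((x - y) \<bullet> grad f y)) = 0" by simp
  have "(LINT x|lborel. h (y - x) * f' x) - f y
     = (LINT x|lborel. h (y - x) * f' x) - (LINT x|lborel. h (y - x) * f y)
       - (LINT x|lborel. h (y - x) * ((x - y) \<bullet> grad f y))"
    by (simp add: h_int odd0)
  also have "\<dots> = (LINT x|lborel. h (y - x) * f' x - h (y - x) * f y - h (y - x) * ((x - y) \<bullet> grad f y))"
    using i1 i2 int_h by simp
  also have "\<bar>\<dots>\<bar> \<le> (LINT x|lborel. h (y - x) * (G * \<epsilon> powr (1 + \<alpha>)))"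
  proof (rule order_trans[OF integral_abs_bound], rule integral_mono)
    show "integrable lborel (\<lambda>x. h (y - x) * (G * \<epsilon> powr (1 + \<alpha>)))" using int_h by simp
    show "integrable lborel (\<lambda>x. \<bar>h (y - x) * f' x - h (y - x) * f y - h (y - x) * ((x - y) \<bullet> grad f y)\<bar>)"
      using i1 i2 int_h by simp
    fix x
    show "\<bar>h (y - x) * f' x - h (y - x) * f y - h (y - x) * ((x - y) \<bullet> grad f y)\<bar>
        \<le> h (y - x) * (G * \<epsilon> powr (1 + \<alpha>))"
    proof (cases "h (y - x) = 0")
      case False
      then have xy: "norm (x - y) \<le> \<epsilon>"
        using support[of "y - x"] by (simp add: norm_minus_commute)
      have "x \<in> cball y \<epsilon>" "y \<in> cball y \<epsilon>"
        using xy eps_nonneg by (auto simp: dist_norm norm_minus_commute)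
      then have seg: "closed_segment y x \<subseteq> \<Omega>"
        using sub closed_segment_subset[OF _ _ convex_cball, of y y \<epsilon> x] by blast
      then have "f' x = f x" by (auto simp: f'_def)
      then have "\<bar>h (y - x) * f' x - h (y - x) * f y - h (y - x) * ((x - y) \<bullet> grad f y)\<bar>
          = h (y - x) * \<bar>f x - f y - (x - y) \<bullet> grad f y\<bar>"
        using nonneg by (simp add: abs_mult right_diff_distrib[symmetric])
      also have "\<dots> \<le> h (y - x) * (G * norm (x - y) powr (1 + \<alpha>))"
        unfolding G_def by (intro mult_left_mono first_order_expansion assms seg nonneg)
      also have "\<dots> \<le> h (y - x) * (G * \<epsilon> powr (1 + \<alpha>))"
        using xy \<open>0 < \<alpha>\<close> G by (intro mult_left_mono powr_mono2 nonneg) (auto simp: G_def)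
      finally show ?thesis .
    qed simp
  qed
  also have "\<dots> = G * \<epsilon> powr (1 + \<alpha>)"
    by (simp add: h_int)
  finally show ?thesis
    unfolding G_def f'_def .
qed

text \<open>By nonnegativity the integral may be restricted to a small ball on which both the kernel
  and \<open>f\<close> are bounded below; the left side is the product of these bounds with the
  volume.\<close>

lemma (in step_kernel) kernel_average_lower:
  fixes f :: "'a \<Rightarrow> real"
  assumes [measurable]: "f \<in> borel_measurable borel"
    and f: "\<And>x. 0 \<le> f x" "\<And>x. f x \<le> P"
    and h: "\<And>z. norm z < t \<Longrightarrow> q \<le> h z" and "0 \<le> q" "0 \<le> l" "0 \<le> s"
    and sub: "ball z s \<subseteq> ball y t" and lower: "\<And>x. x \<in> ball z s \<Longrightarrow> l \<le> f x"
  shows "q * l * (unit_ball_vol (real DIM('a)) * s ^ DIM('a)) \<le> (LINT x|lborel. h (y - x) * f x)"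
proof -
  have "q * l * (unit_ball_vol (real DIM('a)) * s ^ DIM('a)) = (LINT x|lborel. indicator (ball z s) x * (q * l))"
    using \<open>0 \<le> s\<close> by (simp add: content_ball)
  also have "\<dots> \<le> (LINT x|lborel. h (y - x) * f x)"
  proof (rule integral_mono)
    show "integrable lborel (\<lambda>x. h (y - x) * f x)"
      using ennreal_integral_kernel(3)[of "\<lambda>_. 1" f 1 P y] f by simp
    show "integrable lborel (\<lambda>x. indicator (ball z s) x * (q * l))"
      using emeasure_lborel_ball_finite[of z s] by (intro integrable_mult_left integrable_real_indicator) auto
    fix x
    show "indicator (ball z s) x * (q * l) \<le> h (y - x) * f x"
    proof (cases "x \<in> ball z s")
      case True
      then have "norm (y - x) < t" using sub by (auto simp: dist_norm)
      then have "q * l \<le> h (y - x) * f x"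
        using h lower[OF True] \<open>0 \<le> q\<close> \<open>0 \<le> l\<close> nonneg by (intro mult_mono) auto
      with True show ?thesis by simp
    qed (use nonneg f in auto)
  qed
  finally show ?thesis .
qed

section \<open>Elementary estimates behind the radius \<open>R_k\<close> and the smallness
  conditions\<close>

lemma ln_ratio_nonneg:
  fixes \<epsilon> :: real
  assumes "0 < \<epsilon>" "\<epsilon> \<le> 1" "1 \<le> k"
  shows "0 \<le> ln (real k / \<epsilon> ^ n)"
proof -
  have "\<epsilon> ^ n \<le> 1" using assms by (intro power_le_one) auto
  then have "1 \<le> real k / \<epsilon> ^ n" using assms by (simp add: pos_le_divide_eq)
  then show ?thesis by (rule ln_ge_zero)
qed

text \<open>The purpose of \<open>R_k\<close>: the exponent on the left exceeds the one on the right
  by at least the logarithm \<open>L\<close>, and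
  \<open>exp (- L) = \<epsilon> ^ (d + 2) / k\<close> cancels the prefactor up to
  \<open>\<epsilon>\<^sup>2\<close>.\<close>

lemma tail_le_at_radius:
  fixes d k :: nat
  assumes \<epsilon>: "0 < \<epsilon>" "\<epsilon> \<le> 1" and k: "1 \<le> k" and d: "1 \<le> d" and R: "R_k d \<epsilon> k \<le> R"
  shows "real k / \<epsilon> ^ d * exp (- ((R - \<epsilon>)\<^sup>2 / (2 * real d * real k * \<epsilon>\<^sup>2)))
    \<le> \<epsilon>\<^sup>2 * exp (- (R\<^sup>2 / (4 * real d * (eps_k \<epsilon> k)\<^sup>2)))"
proof -
  define L where "L = ln (real k / \<epsilon> ^ (d + 2))"
  define q where "q = \<epsilon>\<^sup>2 * real k"
  define t where "t = R - 5 * \<epsilon>"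
  have q: "(eps_k \<epsilon> k)\<^sup>2 = q" "0 < q"
    using \<epsilon> k by (auto simp: eps_k_def q_def power_mult_distrib)
  have ek: "0 \<le> eps_k \<epsilon> k" using \<epsilon> by (simp add: eps_k_def)
  have L: "0 \<le> L" unfolding L_def by (rule ln_ratio_nonneg[OF \<epsilon> k])
  have "eps_k \<epsilon> k * sqrt (8 * real d * L) \<le> t"
    using R by (simp add: R_k_def t_def L_def)
  moreover have "0 \<le> eps_k \<epsilon> k * sqrt (8 * real d * L)"
    using ek L by simp
  ultimately have t: "0 \<le> t" "(eps_k \<epsilon> k * sqrt (8 * real d * L))\<^sup>2 \<le> t\<^sup>2"
    by (auto intro: power_mono)
  then have tq: "q * (8 * real d * L) \<le> t\<^sup>2"
    using L by (simp add: power_mult_distrib q)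
  \<comment> \<open>The \<open>5 * \<epsilon>\<close> in the radius makes up for the exit radius being \<open>R - \<epsilon>\<close> instead of \<open>R\<close>.\<close>
  have "q * (4 * real d * L) \<le> q * (8 * real d * L)"
    using q(2) L by (intro mult_left_mono mult_right_mono) auto
  also have "\<dots> \<le> 2 * (R - \<epsilon>)\<^sup>2 - R\<^sup>2"
  proof -
    have "2 * (R - \<epsilon>)\<^sup>2 - R\<^sup>2 = t\<^sup>2 + 6 * (t * \<epsilon>) + 7 * \<epsilon>\<^sup>2"
      unfolding t_def by (simp add: power2_eq_square algebra_simps)
    moreover have "0 \<le> t * \<epsilon>" using t \<epsilon> by simp
    ultimately show ?thesis using tq zero_le_power2[of \<epsilon>] by linarith
  qed
  finally have "L \<le> (2 * (R - \<epsilon>)\<^sup>2 - R\<^sup>2) / (4 * real d * q)"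
    using q(2) d by (simp add: pos_le_divide_eq ac_simps)
  also have "\<dots> = (R - \<epsilon>)\<^sup>2 / (2 * real d * real k * \<epsilon>\<^sup>2) - R\<^sup>2 / (4 * real d * q)"
    using \<epsilon> k d by (simp add: q_def field_simps)
  finally have "exp (- ((R - \<epsilon>)\<^sup>2 / (2 * real d * real k * \<epsilon>\<^sup>2))) \<le> exp (- L + - (R\<^sup>2 / (4 * real d * q)))"
    by simp
  also have "\<dots> = \<epsilon> ^ (d + 2) / real k * exp (- (R\<^sup>2 / (4 * real d * q)))"
    unfolding exp_add using \<epsilon> k by (simp add: L_def exp_minus)
  finally have "real k / \<epsilon> ^ d * exp (- ((R - \<epsilon>)\<^sup>2 / (2 * real d * real k * \<epsilon>\<^sup>2)))
      \<le> real k / \<epsilon> ^ d * (\<epsilon> ^ (d + 2) / real k * exp (- (R\<^sup>2 / (4 * real d * q))))"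
    using \<epsilon> by (intro mult_left_mono) auto
  also have "\<dots> = \<epsilon>\<^sup>2 * exp (- (R\<^sup>2 / (4 * real d * q)))"
    using \<epsilon> k by (simp add: power_add power2_eq_square field_simps)
  finally show ?thesis by (simp add: q)
qed

text \<open>Upper bound through \<open>exp\<close>, which is at most \<open>1 + 2 * u\<close> for
  \<open>u\<close> in \<open>[0, 1/2]\<close>; lower bound by Bernoulli.\<close>

lemma power_near_one:
  fixes \<delta> :: real
  assumes "0 \<le> \<delta>" "real k * \<delta> \<le> 1 / 2"
  shows "(1 + \<delta>) ^ k \<le> 1 + 2 * (real k * \<delta>)" and "\<delta> \<le> 1 \<Longrightarrow> 1 - real k * \<delta> \<le> (1 - \<delta>) ^ k"
proof -
  have "(1 + \<delta>) ^ k \<le> exp \<delta> ^ k"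
    using assms(1) by (intro power_mono) (auto simp: exp_ge_add_one_self)
  also have "\<dots> = exp (real k * \<delta>)" by (simp add: exp_of_nat_mult)
  also have "\<dots> \<le> 1 + 2 * (real k * \<delta>)"
    using exp_bound_lemma[of "real k * \<delta>"] assms by simp
  finally show "(1 + \<delta>) ^ k \<le> 1 + 2 * (real k * \<delta>)" .
  show "1 - real k * \<delta> \<le> (1 - \<delta>) ^ k" if "\<delta> \<le> 1"
    using Bernoulli_inequality[of "- \<delta>" k] that by simp
qed

section \<open>The repeated convolution and the smoothed density in terms of the step kernel\<close>

lemma \<psi>_eq_conv_pow:
  fixes x :: "'a::euclidean_space"
  assumes "step_kernel (\<lambda>z::'a. scaled_kernel DIM('a) \<eta> \<epsilon> (norm z)) \<epsilon>"
    and H: "\<And>z::'a. scaled_kernel DIM('a) \<eta> \<epsilon> (norm z) \<le> H"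
  shows "\<psi> \<eta> \<epsilon> (k + 1) (x - x0)
    = enn2real (step_kernel.conv_pow (\<lambda>z::'a. scaled_kernel DIM('a) \<eta> \<epsilon> (norm z)) k x0 x)"
proof -
  interpret step_kernel "\<lambda>z::'a. scaled_kernel DIM('a) \<eta> \<epsilon> (norm z)" \<epsilon> by (rule assms(1))
  let ?h = "\<lambda>z::'a. scaled_kernel DIM('a) \<eta> \<epsilon> (norm z)"
  \<comment> \<open>With \<open>k + 1\<close> factors there are \<open>k\<close> convolutions
    applied to the kernel, which matches \<open>conv_pow k\<close>.\<close>
  have "(convolve ?h ^^ k) ?h (x - x0)
      = enn2real ((kernel_op (\<lambda>z. ennreal (?h z)) (\<lambda>y. ennreal ((\<lambda>_. 1) y)) ^^ k) (\<lambda>y. ennreal (?h y)) (x - x0))"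
    by (rule ennreal_iterate[where W = 1 and K = H]) (use nonneg H in \<open>auto simp: convolve_def\<close>)
  then show ?thesis
    unfolding conv_pow_translate[of k x0 x] by (simp add: \<psi>_def)
qed

text \<open>By continuity at 0 the profile is at least \<open>\<eta> 0 / 2\<close> on
  \<open>[0, \<delta>)\<close>. Even for \<open>y\<close> near the boundary, the ball of radius
  \<open>\<delta> * \<epsilon>\<close> about \<open>y\<close> contains a proportional ball inside
  \<Omega>, where the density is at least \<open>\<rho>_min\<close>. The constants are fixed before
  the density and the scale.\<close>

lemma smoothed_density_lower:
  fixes \<eta> :: "real \<Rightarrow> real" and \<Omega> :: "'a::euclidean_space set"
  assumes "0 < \<eta> 0" "continuous (at 0 within {0..}) \<eta>"
    and \<Omega>: "open \<Omega>" "bounded \<Omega>" "lipschitz_boundary \<Omega>" and \<rho>_min: "0 < \<rho>_min"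
  obtains c0 c1 where "0 < c0" "0 < c1"
    "\<And>\<epsilon> \<rho> P y. step_kernel (\<lambda>z::'a. scaled_kernel DIM('a) \<eta> \<epsilon> (norm z)) \<epsilon> \<Longrightarrow> 0 < \<epsilon> \<Longrightarrow> \<epsilon> \<le> c0 \<Longrightarrow>
      (\<lambda>x. indicator \<Omega> x * \<rho> x) \<in> borel_measurable borel \<Longrightarrow>
      (\<And>x. x \<in> \<Omega> \<Longrightarrow> \<rho>_min \<le> \<rho> x \<and> \<rho> x \<le> P) \<Longrightarrow> y \<in> \<Omega> \<Longrightarrow>
      c1 \<le> (LINT x|lborel. scaled_kernel DIM('a) \<eta> \<epsilon> (norm (y - x)) * (indicator \<Omega> x * \<rho> x))"
proof -
  obtain \<delta> where \<delta>: "0 < \<delta>" "\<And>t. 0 \<le> t \<Longrightarrow> t < \<delta> \<Longrightarrow> \<eta> 0 / 2 \<le> \<eta> t"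
  proof -
    obtain \<delta> where "0 < \<delta>" "\<And>t. t \<in> {0..} \<Longrightarrow> dist t 0 < \<delta> \<Longrightarrow> dist (\<eta> t) (\<eta> 0) < \<eta> 0 / 2"
      using assms(1,2) half_gt_zero unfolding continuous_within_eps_delta by metis
    note this(2)[unfolded dist_real_def]
    then have "\<bar>\<eta> t - \<eta> 0\<bar> < \<eta> 0 / 2" if "0 \<le> t" "t < \<delta>" for t
      using that by simp
    then have "\<eta> 0 / 2 \<le> \<eta> t" if "0 \<le> t" "t < \<delta>" for t
      using that by (smt (verit) field_sum_of_halves)
    with \<open>0 < \<delta>\<close> show ?thesis by (rule that)
  qed
  obtain r \<kappa> where r: "0 < r" and \<kappa>: "0 < \<kappa>"
    and inner: "\<And>y t. y \<in> \<Omega> \<Longrightarrow> 0 < t \<Longrightarrow> t \<le> r \<Longrightarrow> \<exists>z. ball z (\<kappa> * t) \<subseteq> \<Omega> \<inter> ball y t"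
    using lipschitz_boundary_inner_ball[OF \<Omega>] by blast
  define v where "v = unit_ball_vol (real DIM('a))"
  have v: "0 < v" by (simp add: v_def)
  define c1 where "c1 = \<eta> 0 / 2 * \<rho>_min * (v * (\<kappa> * \<delta>) ^ DIM('a))"
  show ?thesis
  proof (rule that)
    show "0 < r / \<delta>" "0 < c1"
      unfolding c1_def using r \<delta> \<kappa> v assms(1) \<rho>_min by auto
    fix \<epsilon> P :: real and \<rho> :: "'a \<Rightarrow> real" and y
    assume sk: "step_kernel (\<lambda>z::'a. scaled_kernel DIM('a) \<eta> \<epsilon> (norm z)) \<epsilon>"
      and \<epsilon>: "0 < \<epsilon>" "\<epsilon> \<le> r / \<delta>"
      and f_meas: "(\<lambda>x. indicator \<Omega> x * \<rho> x) \<in> borel_measurable borel"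
      and \<rho>: "\<And>x. x \<in> \<Omega> \<Longrightarrow> \<rho>_min \<le> \<rho> x \<and> \<rho> x \<le> P" and y: "y \<in> \<Omega>"
    interpret step_kernel "\<lambda>z::'a. scaled_kernel DIM('a) \<eta> \<epsilon> (norm z)" \<epsilon> by (rule sk)
    have "\<delta> * \<epsilon> \<le> r" using \<epsilon> \<delta> by (simp add: pos_le_divide_eq mult.commute)
    then obtain z where z: "ball z (\<kappa> * (\<delta> * \<epsilon>)) \<subseteq> \<Omega> \<inter> ball y (\<delta> * \<epsilon>)"
      using inner[OF y, of "\<delta> * \<epsilon>"] \<delta> \<epsilon> by auto
    have "\<eta> 0 / 2 / \<epsilon> ^ DIM('a) * \<rho>_min * (v * (\<kappa> * (\<delta> * \<epsilon>)) ^ DIM('a))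
        \<le> (LINT x|lborel. scaled_kernel DIM('a) \<eta> \<epsilon> (norm (y - x)) * (indicator \<Omega> x * \<rho> x))"
      unfolding v_def
    proof (rule kernel_average_lower[where P = P and z = z and t = "\<delta> * \<epsilon>"])
      show "0 \<le> indicator \<Omega> x * \<rho> x" for x
        using \<rho>[of x] \<rho>_min by (auto simp: indicator_def)
      show "indicator \<Omega> x * \<rho> x \<le> P" for x
        using \<rho>[of x] \<rho>[OF y] \<rho>_min by (auto simp: indicator_def)
      show "\<eta> 0 / 2 / \<epsilon> ^ DIM('a) \<le> scaled_kernel DIM('a) \<eta> \<epsilon> (norm x)" if "norm x < \<delta> * \<epsilon>" for x :: 'a
        unfolding scaled_kernel_def using that \<epsilon> \<delta>
        by (intro divide_right_mono \<delta>(2)) (auto simp: pos_divide_less_eq)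
      show "\<rho>_min \<le> indicator \<Omega> x * \<rho> x" if "x \<in> ball z (\<kappa> * (\<delta> * \<epsilon>))" for x
        using that z \<rho> by (auto simp: indicator_def)
      show "(\<lambda>x. indicator \<Omega> x * \<rho> x) \<in> borel_measurable borel" by (rule f_meas)
    qed (use \<epsilon> \<delta> \<kappa> z assms(1) \<rho>_min in auto)
    \<comment> \<open>The volume of the inner ball cancels the normalisation of the kernel, so the
      bound does not depend on \<epsilon>.\<close>
    moreover have "\<eta> 0 / 2 / \<epsilon> ^ DIM('a) * \<rho>_min * (v * (\<kappa> * (\<delta> * \<epsilon>)) ^ DIM('a)) = c1"
      using \<epsilon> by (simp add: c1_def power_mult_distrib)
    ultimately show "c1 \<le> (LINT x|lborel. scaled_kernel DIM('a) \<eta> \<epsilon> (norm (y - x)) * (indicator \<Omega> x * \<rho> x))"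
      by simp
  qed
qed

section \<open>Expansion of the iterated average\<close>

theorem theorem4p19:
  fixes \<eta> :: "real \<Rightarrow> real" and \<Omega> :: "'a::euclidean_space set" and \<rho>_min \<rho>_max :: real
  assumes \<eta>_nonneg: "\<And>t. 0 \<le> t \<Longrightarrow> 0 \<le> \<eta> t"
    and \<eta>_cont: "continuous (at 0 within {0..}) \<eta>"
    and \<eta>_pos: "0 < \<eta> 0"
    and \<eta>_noninc: "antimono_on {0..} \<eta>"
    and \<eta>_supp: "closure {t. 0 \<le> t \<and> \<eta> t \<noteq> 0} \<subseteq> {0..1}"
    and \<eta>_mass: "(LINT z:ball (0::'a) 1|lborel. \<eta> (norm z)) = 1"
    and \<Omega>: "open \<Omega>" "connected \<Omega>" "\<Omega> \<noteq> {}" "bounded \<Omega>" "lipschitz_boundary \<Omega>"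
    and \<rho>_bounds: "0 < \<rho>_min"
  shows "\<exists>c>0. \<exists>C>0. \<forall>\<alpha>::real. \<forall>\<rho>::'a \<Rightarrow> real. \<forall>\<epsilon>::real. \<forall>k::nat. \<forall>R::real. \<forall>x0\<in>\<Omega>.
     0 < \<alpha> \<and> \<alpha> \<le> 1 \<and>
     C1_holder \<alpha> \<Omega> \<rho> \<and> (\<forall>x\<in>\<Omega>. \<rho>_min \<le> \<rho> x \<and> \<rho> x \<le> \<rho>_max) \<and> (LINT x:\<Omega>|lborel. \<rho> x) = 1 \<and>
     0 < \<epsilon> \<and> \<epsilon> \<le> 1/2 \<and> eps_k \<epsilon> k \<le> 1 \<and>
     1 \<le> k \<and> R_k DIM('a) \<epsilon> k \<le> R \<and> ball x0 R \<subseteq> \<Omega> \<and>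
     grad_seminorm \<alpha> \<Omega> \<rho> * real k * \<epsilon> powr (1 + \<alpha>) \<le> c \<and> \<epsilon> \<le> c \<longrightarrow>
     (\<forall>x\<in>\<Omega>. \<exists>E1 E2 :: real.
        (averaging \<eta> \<epsilon> \<Omega> \<rho> ^^ k) (centered_kernel \<eta> \<epsilon> x0) x = (1 + E1) * \<psi> \<eta> \<epsilon> (k + 1) (x - x0) + E2 \<and>
        \<bar>E1\<bar> \<le> C * grad_seminorm \<alpha> \<Omega> \<rho> * real k * \<epsilon> powr (1 + \<alpha>) \<and>
        \<bar>E2\<bar> \<le> C * \<epsilon>\<^sup>2 * exp (- (R\<^sup>2 / (4 * real DIM('a) * (eps_k \<epsilon> k)\<^sup>2))))"
proof -
  obtain c0 c1 where c0: "0 < c0" and c1: "0 < c1" and lower: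
    "\<And>\<epsilon> \<rho> P y. step_kernel (\<lambda>z::'a. scaled_kernel DIM('a) \<eta> \<epsilon> (norm z)) \<epsilon> \<Longrightarrow> 0 < \<epsilon> \<Longrightarrow> \<epsilon> \<le> c0 \<Longrightarrow>
      (\<lambda>x. indicator \<Omega> x * \<rho> x) \<in> borel_measurable borel \<Longrightarrow>
      (\<And>x. x \<in> \<Omega> \<Longrightarrow> \<rho>_min \<le> \<rho> x \<and> \<rho> x \<le> P) \<Longrightarrow> y \<in> \<Omega> \<Longrightarrow>
      c1 \<le> (LINT x|lborel. scaled_kernel DIM('a) \<eta> \<epsilon> (norm (y - x)) * (indicator \<Omega> x * \<rho> x))"
    using smoothed_density_lower[OF \<eta>_pos \<eta>_cont \<Omega>(1,4,5) \<rho>_bounds] by blast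
  \<comment> \<open>\<open>c0\<close> makes the lower bound on the smoothed density applicable;
    \<open>\<rho>_min / 4\<close> yields \<open>real k * \<delta> \<le> 1 / 2\<close> below.\<close>
  define c where "c = min c0 (\<rho>_min / 4)"
  \<comment> \<open>The factor 4 is 2 from \<open>(1 + \<delta>) ^ k \<le> 2\<close> times 2 from
    the tail bound. The modulus is taken because \<open>\<rho>_max\<close> is known to be positive
    only once a density and a point of \<Omega> are given.\<close>
  define C2 where "C2 = \<eta> 0 * (\<bar>\<rho>_max\<bar> / c1 + 1) * 4 * real DIM('a)"
  define C where "C = 4 / \<rho>_min + C2"
  have C2: "0 < C2" using \<eta>_pos c1 by (auto simp: C2_def intro!: mult_pos_pos add_nonneg_pos)
  have C: "4 / \<rho>_min \<le> C" "C2 \<le> C" "0 < C"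
    using C2 \<rho>_bounds by (auto simp: C_def add_pos_pos)
  have c: "0 < c" "c \<le> c0" "c \<le> \<rho>_min / 4" using c0 \<rho>_bounds by (auto simp: c_def)
  have main: "\<exists>E1 E2 :: real.
        (averaging \<eta> \<epsilon> \<Omega> \<rho> ^^ k) (centered_kernel \<eta> \<epsilon> x0) x = (1 + E1) * \<psi> \<eta> \<epsilon> (k + 1) (x - x0) + E2 \<and>
        \<bar>E1\<bar> \<le> C * grad_seminorm \<alpha> \<Omega> \<rho> * real k * \<epsilon> powr (1 + \<alpha>) \<and>
        \<bar>E2\<bar> \<le> C * \<epsilon>\<^sup>2 * exp (- (R\<^sup>2 / (4 * real DIM('a) * (eps_k \<epsilon> k)\<^sup>2)))"
    if x0: "x0 \<in> \<Omega>" and \<alpha>: "0 < \<alpha>" and C1: "C1_holder \<alpha> \<Omega> \<rho>"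
      and \<rho>: "\<And>x. x \<in> \<Omega> \<Longrightarrow> \<rho>_min \<le> \<rho> x \<and> \<rho> x \<le> \<rho>_max"
      and \<epsilon>: "0 < \<epsilon>" "\<epsilon> \<le> 1 / 2" and k: "1 \<le> k" and R: "R_k DIM('a) \<epsilon> k \<le> R"
      and sub: "ball x0 R \<subseteq> \<Omega>"
      and small: "grad_seminorm \<alpha> \<Omega> \<rho> * real k * \<epsilon> powr (1 + \<alpha>) \<le> c" "\<epsilon> \<le> c"
    for \<alpha> \<rho> \<epsilon> k R x0 x
  proof -
    define h where "h z = scaled_kernel DIM('a) \<eta> \<epsilon> (norm z)" for z :: 'a
    have sk: "step_kernel h \<epsilon>"
      unfolding h_def by (rule step_kernel_scaled_kernel[OF \<eta>_nonneg \<eta>_noninc \<eta>_supp \<eta>_mass \<epsilon>(1)])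
    interpret step_kernel h \<epsilon> by (rule sk)
    define H where "H = \<eta> 0 / \<epsilon> ^ DIM('a)"
    have hH: "h z \<le> H" for z
      unfolding h_def H_def scaled_kernel_def using \<eta>_noninc \<epsilon>
      by (intro divide_right_mono) (auto simp: monotone_on_def)
    \<comment> \<open>Extension by zero turns integrals over \<Omega> into integrals over the whole
      space and makes the weight vanish outside \<Omega>.\<close>
    define \<rho>' where "\<rho>' y = indicator \<Omega> y * \<rho> y" for y
    define \<rho>h where "\<rho>h y = (LINT x|lborel. h (y - x) * \<rho>' x)" for y
    define w where "w y = \<rho>' y / \<rho>h y" for y
    have cont: "continuous_on \<Omega> \<rho>"
      using C1 has_derivative_continuous unfolding C1_holder_def gderiv_def
      by (blast intro: continuous_at_imp_continuous_on)
    have meas' [measurable]: "\<rho>' \<in> borel_measurable borel"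
      using borel_measurable_continuous_on_indicator[OF _ cont] \<Omega>(1) by (simp add: \<rho>'_def[abs_def])
    have [measurable]: "\<rho>h \<in> borel_measurable borel" unfolding \<rho>h_def by measurable
    have [measurable]: "w \<in> borel_measurable borel" unfolding w_def by measurable
    have \<rho>_max: "0 < \<rho>_max" using \<rho>[OF x0] \<rho>_bounds by linarith
    have \<rho>': "0 \<le> \<rho>' y" "\<rho>' y \<le> \<rho>_max" for y
      using \<rho>[of y] \<rho>_bounds \<rho>_max by (auto simp: \<rho>'_def indicator_def)
    have \<rho>h_lower: "c1 \<le> \<rho>h y" if "y \<in> \<Omega>" for y
      unfolding \<rho>h_def \<rho>'_def h_def
      by (rule lower) (use sk \<epsilon> small c \<rho> that meas' in \<open>auto simp: h_def[abs_def] \<rho>'_def[abs_def]\<close>)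
    have \<rho>h_nonneg: "0 \<le> \<rho>h y" for y
      unfolding \<rho>h_def using nonneg \<rho>' by (intro integral_nonneg_AE) auto
    have w0: "0 \<le> w y" for y using \<rho>' \<rho>h_nonneg by (simp add: w_def)
    have w_le: "w y \<le> 1 / c1 * \<rho>' y" for y
    proof (cases "y \<in> \<Omega>")
      case True
      then have "\<rho>' y / \<rho>h y \<le> \<rho>' y / c1"
        using \<rho>h_lower[OF True] c1 \<rho>' by (intro divide_left_mono mult_pos_pos) auto
      then show ?thesis by (simp add: w_def)
    qed (simp add: w_def \<rho>'_def)
    have w_bounded: "w y \<le> 1 / c1 * \<rho>_max" for y
      using w_le[of y] mult_left_mono[OF \<rho>'(2)[of y], of "1 / c1"] c1 by simp
    have avg: "(averaging \<eta> \<epsilon> \<Omega> \<rho> ^^ k) (centered_kernel \<eta> \<epsilon> x0) x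
        = enn2real ((kernel_op (\<lambda>z. ennreal (h z)) (\<lambda>y. ennreal (w y)) ^^ k) (\<lambda>y. ennreal (h (x0 - y))) x)"
    proof -
      have "smoothed_density \<eta> \<epsilon> \<Omega> \<rho> y = \<rho>h y" for y
        unfolding smoothed_density_def \<rho>h_def set_lebesgue_integral_def
        by (intro Bochner_Integration.integral_cong) (auto simp: h_def \<rho>'_def)
      then have "averaging \<eta> \<epsilon> \<Omega> \<rho> f x = (LINT y|lborel. h (x - y) * (w y * f y))" for f x
        unfolding averaging_def set_lebesgue_integral_def
        by (intro Bochner_Integration.integral_cong) (auto simp: h_def \<rho>'_def w_def divide_inverse)
      moreover have "centered_kernel \<eta> \<epsilon> x0 = (\<lambda>y. h (x0 - y))"
        by (simp add: centered_kernel_def[abs_def] h_def)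
      ultimately show ?thesis
        using nonneg hH w0 w_bounded by (simp, intro ennreal_iterate) auto
    qed
    have psi: "\<psi> \<eta> \<epsilon> (k + 1) (x - x0) = enn2real (conv_pow k x0 x)"
      using \<psi>_eq_conv_pow[of \<eta> \<epsilon> H k x x0] sk hH unfolding h_def by simp
    define \<delta>0 where "\<delta>0 = grad_seminorm \<alpha> \<Omega> \<rho> * \<epsilon> powr (1 + \<alpha>)"
    \<comment> \<open>The relative error of the weight: the absolute error \<open>\<delta>0\<close>
      of the smoothed density divided by its lower bound \<open>\<rho>_min / 2\<close> in the inner
      ball.\<close>
    define \<delta> where "\<delta> = 2 * \<delta>0 / \<rho>_min"
    have G: "0 \<le> grad_seminorm \<alpha> \<Omega> \<rho>" by (rule grad_seminorm_nonneg[OF C1 \<Omega>(1,3)])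
    have k\<delta>0: "real k * \<delta>0 \<le> \<rho>_min / 4"
      using small(1) c(3) by (simp add: \<delta>0_def ac_simps)
    have \<delta>0: "0 \<le> \<delta>0" using G by (simp add: \<delta>0_def)
    then have "\<delta>0 \<le> real k * \<delta>0" using k by (simp add: mult_le_cancel_right1)
    then have \<delta>0_le: "\<delta>0 \<le> \<rho>_min / 4" using k\<delta>0 by linarith
    have \<delta>: "0 \<le> \<delta>" "real k * \<delta> \<le> 1 / 2" "\<delta> \<le> 1"
      using \<delta>0 k\<delta>0 \<delta>0_le \<rho>_bounds by (auto simp: \<delta>_def field_simps)
    \<comment> \<open>For points of this smaller ball the whole support of the kernel stays inside
      \<open>ball x0 R\<close>, hence inside \<Omega>.\<close>
    define s where "s = R - \<epsilon>"
    have "5 * \<epsilon> \<le> R"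
    proof -
      have "0 \<le> ln (real k / \<epsilon> ^ (DIM('a) + 2))" using \<epsilon> k by (intro ln_ratio_nonneg) auto
      then have "5 * \<epsilon> \<le> R_k DIM('a) \<epsilon> k" using \<epsilon> by (simp add: R_k_def eps_k_def)
      with R show ?thesis by linarith
    qed
    then have s: "0 \<le> s" using \<epsilon> by (simp add: s_def)
    have w_near: "1 - \<delta> \<le> w y \<and> w y \<le> 1 + \<delta>" if y: "y \<in> ball x0 s" for y
    proof -
      have "cball y \<epsilon> \<subseteq> ball x0 R"
      proof
        fix z assume "z \<in> cball y \<epsilon>"
        then show "z \<in> ball x0 R" using dist_triangle[of x0 z y] y by (simp add: s_def)
      qed
      then have cb: "cball y \<epsilon> \<subseteq> \<Omega>" using sub by blast
      then have y\<Omega>: "y \<in> \<Omega>" using \<epsilon> by auto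
      have close: "\<bar>\<rho>h y - \<rho> y\<bar> \<le> \<delta>0"
        unfolding \<rho>h_def \<delta>0_def \<rho>'_def
        by (rule kernel_average_close[OF C1 \<alpha> G cb, where P = \<rho>_max])
          (use \<rho> \<rho>_bounds meas' in \<open>fastforce simp: \<rho>'_def[abs_def]\<close>)+
      then have half: "\<rho>_min / 2 \<le> \<rho>h y" using \<rho>[OF y\<Omega>] \<delta>0_le \<rho>_bounds by linarith
      have "\<delta>0 = \<delta> * (\<rho>_min / 2)" using \<rho>_bounds by (simp add: \<delta>_def)
      also have "\<dots> \<le> \<delta> * \<rho>h y" by (rule mult_left_mono[OF half \<delta>(1)])
      finally have "\<bar>\<rho>h y - \<rho> y\<bar> \<le> \<delta> * \<rho>h y" using close by linarith
      moreover have "0 < \<rho>h y" using half \<rho>_bounds by linarith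
      ultimately show ?thesis
        using y\<Omega> by (auto simp: w_def \<rho>'_def field_simps abs_le_iff)
    qed
    \<comment> \<open>Integrating \<rho> against the kernel gives the smoothed density, which the
      weight cancels, leaving \<rho>. Where \<open>\<rho>h\<close> vanishes, \<open>w\<close> is 0
      by the convention for division and only the inequality remains.\<close>
    have mass_transport: "(\<integral>\<^sup>+x. ennreal (\<rho>' x) * ennreal (h (x - y)) \<partial>lborel) * ennreal (w y) \<le> ennreal (\<rho>' y)" for y
    proof -
      have "(\<integral>\<^sup>+x. ennreal (\<rho>' x) * ennreal (h (x - y)) \<partial>lborel) = ennreal (\<rho>h y)"
      proof -
        have "h (x - y) = h (y - x)" for x using even[of "x - y"] by simp
        then show ?thesis
          using ennreal_integral_kernel(1)[of "\<lambda>_. 1" \<rho>' 1 \<rho>_max y] \<rho>'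
          by (simp add: \<rho>h_def kernel_op_def mult.commute)
      qed
      then show ?thesis
        using \<rho>h_nonneg[of y] w0[of y] \<rho>'(1)[of y]
        by (cases "\<rho>h y = 0") (auto simp: ennreal_mult[symmetric] w_def)
    qed
    define T where "T = 2 * real DIM('a) * exp (- (s\<^sup>2 / (2 * real DIM('a) * real k * \<epsilon>\<^sup>2)))"
    have "\<exists>E1 E2. enn2real ((kernel_op (\<lambda>z. ennreal (h z)) (\<lambda>y. ennreal (w y)) ^^ k) (\<lambda>y. ennreal (h (x0 - y))) x)
       = (1 + E1) * enn2real (conv_pow k x0 x) + E2
     \<and> (1 - \<delta>) ^ k \<le> 1 + E1 \<and> 1 + E1 \<le> (1 + \<delta>) ^ k
     \<and> \<bar>E2\<bar> \<le> H * (1 / c1 * \<rho>_max + 1) * (1 + \<delta>) ^ k * real k * T"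
      unfolding T_def
    proof (rule iterate_expansion[where m = "\<lambda>y. ennreal (\<rho>' y)"])
      show "ennreal (w y) \<le> ennreal (1 / c1) * ennreal (\<rho>' y)" for y
        using w_le[of y] c1 \<rho>' by (simp add: ennreal_mult'[symmetric] ennreal_leI)
      show "ennreal (w y) \<le> ennreal (1 + \<delta>)" "ennreal (1 - \<delta>) \<le> ennreal (w y)" if "y \<in> ball x0 s" for y
        using w_near[OF that] by (blast intro: ennreal_leI)+
    qed (use hH mass_transport \<rho>' \<delta> c1 \<rho>_max s \<epsilon> in \<open>auto intro!: ennreal_leI\<close>)
    then obtain E1 E2 where E: "(averaging \<eta> \<epsilon> \<Omega> \<rho> ^^ k) (centered_kernel \<eta> \<epsilon> x0) x
         = (1 + E1) * \<psi> \<eta> \<epsilon> (k + 1) (x - x0) + E2"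
      and E1: "(1 - \<delta>) ^ k \<le> 1 + E1" "1 + E1 \<le> (1 + \<delta>) ^ k"
      and E2: "\<bar>E2\<bar> \<le> H * (1 / c1 * \<rho>_max + 1) * (1 + \<delta>) ^ k * real k * T"
      unfolding avg psi by blast
    have b_le: "(1 + \<delta>) ^ k \<le> 1 + 2 * (real k * \<delta>)"
      by (rule power_near_one(1)[OF \<delta>(1,2)])
    \<comment> \<open>The powers of \<open>1 - \<delta>\<close> and \<open>1 + \<delta>\<close> both
      deviate from 1 by at most this; by the definition of \<delta> it is the source of
      \<open>4 / \<rho>_min\<close> in \<open>C\<close>.\<close>
    have "\<bar>E1\<bar> \<le> 2 * (real k * \<delta>)"
      using E1 b_le power_near_one(2)[OF \<delta>] \<delta>(1) mult_nonneg_nonneg[of "real k" \<delta>]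
      by (simp add: abs_le_iff)
    also have "\<dots> = 4 / \<rho>_min * (grad_seminorm \<alpha> \<Omega> \<rho> * real k * \<epsilon> powr (1 + \<alpha>))"
      by (simp add: \<delta>_def \<delta>0_def)
    also have "\<dots> \<le> C * (grad_seminorm \<alpha> \<Omega> \<rho> * real k * \<epsilon> powr (1 + \<alpha>))"
      using C(1) G by (intro mult_right_mono) auto
    finally have E1_le: "\<bar>E1\<bar> \<le> C * grad_seminorm \<alpha> \<Omega> \<rho> * real k * \<epsilon> powr (1 + \<alpha>)"
      by (simp add: mult.assoc)
    let ?X = "\<epsilon>\<^sup>2 * exp (- (R\<^sup>2 / (4 * real DIM('a) * (eps_k \<epsilon> k)\<^sup>2)))"
    have H0: "0 \<le> H" using \<eta>_pos \<epsilon> by (simp add: H_def)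
    have "H * (1 / c1 * \<rho>_max + 1) * (1 + \<delta>) ^ k * real k * T
        \<le> H * (1 / c1 * \<rho>_max + 1) * 2 * real k * T"
      using b_le \<delta>(2) H0 c1 \<rho>_max
      by (intro mult_right_mono mult_left_mono) (auto simp: T_def intro!: mult_nonneg_nonneg)
    also have "\<dots> = C2 * (real k / \<epsilon> ^ DIM('a) * exp (- (s\<^sup>2 / (2 * real DIM('a) * real k * \<epsilon>\<^sup>2))))"
      using \<rho>_max by (simp add: C2_def H_def T_def)
    also have "\<dots> \<le> C2 * ?X"
      unfolding s_def using C2 \<epsilon> k R
      by (intro mult_left_mono tail_le_at_radius) (auto simp: DIM_positive Suc_leI)
    also have "\<dots> \<le> C * ?X"
      using C(2) by (intro mult_right_mono) auto
    finally have E2_le: "\<bar>E2\<bar> \<le> C * \<epsilon>\<^sup>2 * exp (- (R\<^sup>2 / (4 * real DIM('a) * (eps_k \<epsilon> k)\<^sup>2)))"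
      using E2 by (simp add: mult.assoc)
    show ?thesis using E E1_le E2_le by blast
  qed
  show ?thesis
  proof (rule exI[of _ c], rule conjI[OF c(1)], rule exI[of _ C], rule conjI[OF C(3)],
      intro allI ballI impI, elim conjE)
    fix \<alpha> \<rho> \<epsilon> k R x0 x
    assume "x0 \<in> \<Omega>" "0 < \<alpha>" "C1_holder \<alpha> \<Omega> \<rho>" "\<forall>x\<in>\<Omega>. \<rho>_min \<le> \<rho> x \<and> \<rho> x \<le> \<rho>_max"
      "0 < \<epsilon>" "\<epsilon> \<le> 1 / 2" "1 \<le> k" "R_k DIM('a) \<epsilon> k \<le> R" "ball x0 R \<subseteq> \<Omega>"
      "grad_seminorm \<alpha> \<Omega> \<rho> * real k * \<epsilon> powr (1 + \<alpha>) \<le> c" "\<epsilon> \<le> c"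
    then show "\<exists>E1 E2 :: real.
        (averaging \<eta> \<epsilon> \<Omega> \<rho> ^^ k) (centered_kernel \<eta> \<epsilon> x0) x = (1 + E1) * \<psi> \<eta> \<epsilon> (k + 1) (x - x0) + E2 \<and>
        \<bar>E1\<bar> \<le> C * grad_seminorm \<alpha> \<Omega> \<rho> * real k * \<epsilon> powr (1 + \<alpha>) \<and>
        \<bar>E2\<bar> \<le> C * \<epsilon>\<^sup>2 * exp (- (R\<^sup>2 / (4 * real DIM('a) * (eps_k \<epsilon> k)\<^sup>2)))"
      by (intro main) auto
  qed
qed

end
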